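(* Let $G=\langle a_1,\dots,a_d\rangle$ be a level transitive spinal Hanoi towers group acting on $\mathcal T_d$, and let $J\leq\mathrm{Aut}(\mathcal T_d)$ be the associated subgroup defined in the context. If $J\leq G$, then: (1) $G$ is strongly fractal; (2) $G$ is regular branch over $G'$; (3) $\psi(\mathrm{St}_G(1))=\left\{(g_1,\ldots,g_d)\in G\times\cdots\times G\ (d\text{ factors})\ \middle|\ \sum_{j=1}^d \varepsilon(g_j)\in \ker(\lambda)\right\}$; (4) $\psi_m(\mathrm{Rist}_G(m))=B\times\cdots\times B$ ($d^m$ factors) for every $m\geq 1$, where $B=\rho^{-1}(P')$; (5) $G$ is just infinite. Note that, for a spinal Hanoi towers group $G$ that is regular branch over $G'$, the containment $J\leq G$ can be verified in the finite group $\bigl(\prod_{i=1}^d\mathbb{Z}/o(a_i)\mathbb{Z}\bigr)^d\rtimes P$.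
   Context: Tree and conventions. $\mathcal T_d$ is the $d$-regular rooted tree whose vertices are the finite words over $X=\{1,\dots,d\}$. Automorphisms and permutations act on the right and products are read from left to right. For $g\in\mathrm{Aut}(\mathcal T_d)$ and a vertex $v$, the section $g|_v$ is defined by $(vw)^g=v^g\,w^{g|_v}$; thus $(gh)|_v=g|_v\,h|_{v^g}$. We write $\psi(g)=(g|_1,\dots,g|_d)\tau$, where $\tau\in\mathrm{Sym}(d)$ (the root permutation) is the action of $g$ on the first level; when $\tau=1$ we identify $\psi(g)$ with the tuple $(g|_1,\dots,g|_d)$. $\mathrm{St}(n)$ is the pointwise stabilizer of level $n$ in $\mathrm{Aut}(\mathcal T_d)$, $\mathrm{St}_G(n)=G\cap\mathrm{St}(n)$, and $\psi_m:\mathrm{St}(m)\to\mathrm{Aut}(\mathcal T_d)^{d^m}$ sends $g$ to the tuple of its sections at the vertices of level $m$. For a group $H$, $H'$ denotes its commutator subgroup, and $o(x)$ denotes the order of an element $x$. Spinal Hanoi towers groups. Given $\sigma_1,\dots,\sigma_d\in\mathrm{Sym}(d)$ with $\sigma_i\neq 1$ and $\sigma_i$ fixing $i$ for each $i$, let $a_i\in\mathrm{Aut}(\mathcal T_d)$ be defined recursively by $\psi(a_i)=(1,\dots,1,a_i,1,\dots,1)\sigma_i$, with $a_i$ in the $i$-th coordinate. Any group $G=\langle a_1,\dots,a_d\rangle$ of this form is a spinal Hanoi towers group; set $P=\langle\sigma_1,\dots,\sigma_d\rangle\le\mathrm{Sym}(d)$. The order $o(a_i)$ is finite and equals the order of $\sigma_i$.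 The subgroup $J$. $J$ is the subgroup of $\mathrm{Aut}(\mathcal T_d)$ generated by all $g\in\mathrm{St}(1)$ for which there are $h\in G$ and two distinct coordinates $p,q\in\{1,\dots,d\}$ such that $\psi(g)$ has $h$ in coordinate $p$, $h^{-1}$ in coordinate $q$, and trivial entries elsewhere. A priori these elements need not belong to $G$. Maps. $\varepsilon:G\to\prod_{i=1}^d\mathbb Z/o(a_i)\mathbb Z$ is the (well-defined) surjective homomorphism sending $a_i$ to the $i$-th standard generator; its kernel is $G'$ and it induces an isomorphism $\overline\varepsilon$ from $G/G'$. $\rho:G\to P$ sends $g$ to its root permutation, and induces $\overline\rho:G/G'\to P/P'$. $\lambda:\prod_{i=1}^d\mathbb Z/o(a_i)\mathbb Z\to P/P'$ is $\lambda=\overline\rho\circ\overline\varepsilon^{-1}$. The finite group. In $\bigl(\prod_{i=1}^d\mathbb{Z}/o(a_i)\mathbb{Z}\bigr)^d\rtimes P$, the group $P$ acts by permuting the $d$ coordinates. Properties. $G$ is level transitive if it is transitive on each level. A self-similar $G$ (all sections of elements of $G$ lie in $G$) is strongly fractal if $\{g|_x:g\in\mathrm{St}_G(1)\}=G$ for every $x\in X$. $G$ is regular branch over $K\le G$ if $G$ is level transitive, $|G:K|<\infty$, and $K\times\cdots\times K$ ($d$ factors) is contained in $\psi(K\cap\mathrm{St}(1))$. For a vertex $v$, $\mathrm{rist}_G(v)$ is the subgroup of elements of $G$ acting trivially outside the subtree rooted at $v$, and $\mathrm{Rist}_G(m)=\prod_{|v|=m}\mathrm{rist}_G(v)$. A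 group is just infinite if it is infinite and all its proper quotients are finite. *)

theory Defs
  imports "HOL-Algebra.Algebra" "HOL-Library.Sublist"
begin

text \<open>
  The alphabet \<open>X\<close> is a finite type \<open>'x\<close>, with \<open>d = CARD('x)\<close>; vertices are words of type
  \<open>'x list\<close>. Groups act on the right and products are read from left to right, so the
  product of \<open>g\<close> and \<open>h\<close> is the function \<open>h \<circ> g\<close>.
\<close>

definition Sym_right :: "('a \<Rightarrow> 'a) monoid" where
  "Sym_right = \<lparr>carrier = {f. bij f}, monoid.mult = (\<lambda>f g. g \<circ> f), one = id\<rparr>"

text \<open>
  Automorphisms of the rooted tree are the automorphisms of its ancestor order; they fix the
  root, preserve levels and preserve adjacency.
\<close>

definition tree_auts :: "('x list \<Rightarrow> 'x list) set" where
  "tree_auts = {g. bij g \<and> (\<forall>u v. prefix (g u) (g v) \<longleftrightarrow> prefix u v)}"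

definition tree_Aut :: "('x list \<Rightarrow> 'x list) monoid" where
  "tree_Aut = Sym_right\<lparr>carrier := tree_auts\<rparr>"

definition level :: "nat \<Rightarrow> 'x list set" where
  "level n = {v. length v = n}"

text \<open>For a tree automorphism, \<open>g (v @ w) = g v @ tree_section g v w\<close>.\<close>

definition tree_section :: "('x list \<Rightarrow> 'x list) \<Rightarrow> 'x list \<Rightarrow> 'x list \<Rightarrow> 'x list" where
  "tree_section g v = (\<lambda>w. drop (length v) (g (v @ w)))"

definition root_perm :: "('x list \<Rightarrow> 'x list) \<Rightarrow> 'x \<Rightarrow> 'x" where
  "root_perm g = (\<lambda>x. hd (g [x]))"

definition level_stab :: "nat \<Rightarrow> ('x list \<Rightarrow> 'x list) set" where
  "level_stab n = {g \<in> tree_auts. \<forall>v \<in> level n. g v = v}"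

text \<open>
  Both maps below list sections only; they are applied to elements of \<open>level_stab 1\<close>,
  respectively \<open>level_stab m\<close>.
\<close>

definition psi :: "('x list \<Rightarrow> 'x list) \<Rightarrow> 'x \<Rightarrow> 'x list \<Rightarrow> 'x list" where
  "psi g = (\<lambda>x. tree_section g [x])"

definition psi_level ::
    "nat \<Rightarrow> ('x list \<Rightarrow> 'x list) \<Rightarrow> 'x list \<Rightarrow> 'x list \<Rightarrow> 'x list" where
  "psi_level m g = (\<lambda>v \<in> level m. tree_section g v)"

text \<open>Here \<open>G\<close> is the underlying set of a subgroup of \<open>tree_Aut\<close>.\<close>

abbreviation aut_group :: "('x list \<Rightarrow> 'x list) set \<Rightarrow> ('x list \<Rightarrow> 'x list) monoid" where
  "aut_group G \<equiv> tree_Aut\<lparr>carrier := G\<rparr>"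

definition level_transitive :: "('x list \<Rightarrow> 'x list) set \<Rightarrow> bool" where
  "level_transitive G \<longleftrightarrow> (\<forall>n. \<forall>u \<in> level n. \<forall>v \<in> level n. \<exists>g \<in> G. g u = v)"

definition self_similar :: "('x list \<Rightarrow> 'x list) set \<Rightarrow> bool" where
  "self_similar G \<longleftrightarrow> (\<forall>g \<in> G. \<forall>v. tree_section g v \<in> G)"

definition strongly_fractal :: "('x list \<Rightarrow> 'x list) set \<Rightarrow> bool" where
  "strongly_fractal G \<longleftrightarrow> self_similar G \<and>
     (\<forall>x. (\<lambda>g. tree_section g [x]) ` (G \<inter> level_stab 1) = G)"

definition regular_branch_over ::
    "('x list \<Rightarrow> 'x list) set \<Rightarrow> ('x list \<Rightarrow> 'x list) set \<Rightarrow> bool" where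
  "regular_branch_over G K \<longleftrightarrow>
     subgroup K (aut_group G) \<and> level_transitive G \<and>
     finite (rcosets\<^bsub>aut_group G\<^esub> K) \<and>
     {f. \<forall>x. f x \<in> K} \<subseteq> psi ` (K \<inter> level_stab 1)"

definition rist :: "('x list \<Rightarrow> 'x list) set \<Rightarrow> 'x list \<Rightarrow> ('x list \<Rightarrow> 'x list) set" where
  "rist G v = {g \<in> G. \<forall>w. \<not> prefix v w \<longrightarrow> g w = w}"

text \<open>
  Rigid stabilizers of distinct vertices of one level commute, so their product is the
  subgroup they generate.
\<close>

definition Rist :: "('x list \<Rightarrow> 'x list) set \<Rightarrow> nat \<Rightarrow> ('x list \<Rightarrow> 'x list) set" where
  "Rist G m = generate tree_Aut (\<Union>v \<in> level m. rist G v)"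

definition just_infinite :: "('a, 'b) monoid_scheme \<Rightarrow> bool" where
  "just_infinite G \<longleftrightarrow> infinite (carrier G) \<and>
     (\<forall>N. N \<lhd> G \<and> N \<noteq> {\<one>\<^bsub>G\<^esub>} \<longrightarrow> finite (carrier (G Mod N)))"

definition spinal_perms :: "('x \<Rightarrow> 'x \<Rightarrow> 'x) \<Rightarrow> bool" where
  "spinal_perms \<sigma> \<longleftrightarrow> (\<forall>i. bij (\<sigma> i) \<and> \<sigma> i \<noteq> id \<and> \<sigma> i i = i)"

primrec spinal_gen :: "('x \<Rightarrow> 'x \<Rightarrow> 'x) \<Rightarrow> 'x \<Rightarrow> 'x list \<Rightarrow> 'x list" where
  "spinal_gen \<sigma> i [] = []"
| "spinal_gen \<sigma> i (x # w) = \<sigma> i x # (if x = i then spinal_gen \<sigma> i w else w)"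

lemma psi_spinal_gen: "psi (spinal_gen \<sigma> i) = (\<lambda>x. if x = i then spinal_gen \<sigma> i else id)"
  by (auto simp: psi_def tree_section_def fun_eq_iff)

lemma root_perm_spinal_gen: "root_perm (spinal_gen \<sigma> i) = \<sigma> i"
  by (simp add: root_perm_def)

definition hanoi_group :: "('x \<Rightarrow> 'x \<Rightarrow> 'x) \<Rightarrow> ('x list \<Rightarrow> 'x list) set" where
  "hanoi_group \<sigma> = generate tree_Aut (range (spinal_gen \<sigma>))"

definition hanoi_derived :: "('x \<Rightarrow> 'x \<Rightarrow> 'x) \<Rightarrow> ('x list \<Rightarrow> 'x list) set" where
  "hanoi_derived \<sigma> = derived tree_Aut (hanoi_group \<sigma>)"

definition root_group :: "('x \<Rightarrow> 'x \<Rightarrow> 'x) \<Rightarrow> ('x \<Rightarrow> 'x) set" where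
  "root_group \<sigma> = generate Sym_right (range \<sigma>)"

definition root_derived :: "('x \<Rightarrow> 'x \<Rightarrow> 'x) \<Rightarrow> ('x \<Rightarrow> 'x) set" where
  "root_derived \<sigma> = derived Sym_right (root_group \<sigma>)"

definition J_gens :: "('x \<Rightarrow> 'x \<Rightarrow> 'x) \<Rightarrow> ('x list \<Rightarrow> 'x list) set" where
  "J_gens \<sigma> = {g \<in> level_stab 1. \<exists>h \<in> hanoi_group \<sigma>. \<exists>p q. p \<noteq> q \<and>
     psi g = (\<lambda>x. if x = p then h else if x = q then inv\<^bsub>tree_Aut\<^esub> h else id)}"

definition J_group :: "('x \<Rightarrow> 'x \<Rightarrow> 'x) \<Rightarrow> ('x list \<Rightarrow> 'x list) set" where
  "J_group \<sigma> = generate tree_Aut (J_gens \<sigma>)"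

definition exp_group :: "('x \<Rightarrow> 'x \<Rightarrow> 'x) \<Rightarrow> ('x \<Rightarrow> int) monoid" where
  "exp_group \<sigma> = product_group UNIV (\<lambda>i. integer_mod_group (group.ord tree_Aut (spinal_gen \<sigma> i)))"

text \<open>
  The entry \<open>1\<close> is a residue in the carrier \<open>{0..<o(a\<^sub>i)}\<close> because \<open>o(a\<^sub>i) \<ge> 2\<close>.
\<close>

definition std_gen :: "'x \<Rightarrow> 'x \<Rightarrow> int" where
  "std_gen i = (\<lambda>j. if j = i then 1 else 0)"

text \<open>Extensionality fixes the value outside \<open>G\<close>, making the homomorphism unique.\<close>

definition eps :: "('x \<Rightarrow> 'x \<Rightarrow> 'x) \<Rightarrow> ('x list \<Rightarrow> 'x list) \<Rightarrow> 'x \<Rightarrow> int" where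
  "eps \<sigma> = (THE f. f \<in> hom (aut_group (hanoi_group \<sigma>)) (exp_group \<sigma>) \<and>
     f \<in> extensional (hanoi_group \<sigma>) \<and> (\<forall>i. f (spinal_gen \<sigma> i) = std_gen i))"

abbreviation hanoi_ab :: "('x \<Rightarrow> 'x \<Rightarrow> 'x) \<Rightarrow> ('x list \<Rightarrow> 'x list) set monoid" where
  "hanoi_ab \<sigma> \<equiv> aut_group (hanoi_group \<sigma>) Mod hanoi_derived \<sigma>"

abbreviation root_ab :: "('x \<Rightarrow> 'x \<Rightarrow> 'x) \<Rightarrow> ('x \<Rightarrow> 'x) set monoid" where
  "root_ab \<sigma> \<equiv> Sym_right\<lparr>carrier := root_group \<sigma>\<rparr> Mod root_derived \<sigma>"

text \<open>The induced maps take a coset to the common value of its elements.\<close>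

definition eps_bar :: "('x \<Rightarrow> 'x \<Rightarrow> 'x) \<Rightarrow> ('x list \<Rightarrow> 'x list) set \<Rightarrow> 'x \<Rightarrow> int" where
  "eps_bar \<sigma> C = the_elem (eps \<sigma> ` C)"

definition rho_bar :: "('x \<Rightarrow> 'x \<Rightarrow> 'x) \<Rightarrow> ('x list \<Rightarrow> 'x list) set \<Rightarrow> ('x \<Rightarrow> 'x) set" where
  "rho_bar \<sigma> C = the_elem ((\<lambda>g. root_derived \<sigma> #>\<^bsub>Sym_right\<^esub> root_perm g) ` C)"

definition lam :: "('x \<Rightarrow> 'x \<Rightarrow> 'x) \<Rightarrow> ('x \<Rightarrow> int) \<Rightarrow> ('x \<Rightarrow> 'x) set" where
  "lam \<sigma> = rho_bar \<sigma> \<circ> inv_into (carrier (hanoi_ab \<sigma>)) (eps_bar \<sigma>)"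

definition B_group :: "('x \<Rightarrow> 'x \<Rightarrow> 'x) \<Rightarrow> ('x list \<Rightarrow> 'x list) set" where
  "B_group \<sigma> = {g \<in> hanoi_group \<sigma>. root_perm g \<in> root_derived \<sigma>}"

text \<open>
  The multiplication follows \<open>(gh)|\<^sub>x = g|\<^sub>x h|\<^sub>y\<close> with \<open>y = x\<^sup>g\<close>.
\<close>

definition fin_group :: "('x \<Rightarrow> 'x \<Rightarrow> 'x) \<Rightarrow> (('x \<Rightarrow> 'x \<Rightarrow> int) \<times> ('x \<Rightarrow> 'x)) monoid" where
  "fin_group \<sigma> =
     \<lparr>carrier = {f. \<forall>x. f x \<in> carrier (exp_group \<sigma>)} \<times> root_group \<sigma>,
      monoid.mult = (\<lambda>(f, s) (g, t). (\<lambda>x. f x \<otimes>\<^bsub>exp_group \<sigma>\<^esub> g (s x), t \<circ> s)),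
      one = (\<lambda>x. \<one>\<^bsub>exp_group \<sigma>\<^esub>, id)\<rparr>"

text \<open>
  Reduction of an automorphism whose first-level sections lie in \<open>G\<close>; it makes sense on both
  \<open>G\<close> and \<open>J\<close>.
\<close>

definition fin_red ::
    "('x \<Rightarrow> 'x \<Rightarrow> 'x) \<Rightarrow> ('x list \<Rightarrow> 'x list) \<Rightarrow> ('x \<Rightarrow> 'x \<Rightarrow> int) \<times> ('x \<Rightarrow> 'x)" where
  "fin_red \<sigma> g = (\<lambda>x. eps \<sigma> (psi g x), root_perm g)"

text \<open>
  The next two subgroups are written in terms of the finite group alone: they are generated by
  the reductions of the \<open>a\<^sub>i\<close>, respectively of the generators of \<open>J\<close>.
\<close>

definition fin_G :: "('x \<Rightarrow> 'x \<Rightarrow> 'x) \<Rightarrow> (('x \<Rightarrow> 'x \<Rightarrow> int) \<times> ('x \<Rightarrow> 'x)) set" where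
  "fin_G \<sigma> = generate (fin_group \<sigma>)
     (range (\<lambda>i. (\<lambda>x. if x = i then std_gen i else \<one>\<^bsub>exp_group \<sigma>\<^esub>, \<sigma> i)))"

definition fin_J :: "('x \<Rightarrow> 'x \<Rightarrow> 'x) \<Rightarrow> (('x \<Rightarrow> 'x \<Rightarrow> int) \<times> ('x \<Rightarrow> 'x)) set" where
  "fin_J \<sigma> = generate (fin_group \<sigma>)
     {(\<lambda>x. if x = p then c else if x = q then inv\<^bsub>exp_group \<sigma>\<^esub> c else \<one>\<^bsub>exp_group \<sigma>\<^esub>, id)
       | c p q. c \<in> carrier (exp_group \<sigma>) \<and> p \<noteq> q}"

end

theory Submission
  imports Defs
begin

text \<open>
Throughout, \<open>g \<star> h\<close> is the product in the automorphism group of the tree (first \<open>g\<close>, then \<open>h\<close>),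
\<open>G\<close> is the spinal Hanoi towers group, \<open>G'\<close> its derived subgroup and \<open>B\<close> the preimage of the derived
subgroup of the root group.

Since \<open>\<sigma> i\<close> fixes \<open>i\<close>, a letter \<open>a i\<close> of a word in the generators contributes to exactly one
first-level section, and there it contributes the letter \<open>a i\<close> itself. Taking sections therefore
distributes the letters of a word among the letters of the alphabet, and exponent sums are preserved.
A word that represents the identity has sections that do so too, and they are shorter unless the word
is a power of one generator; by induction its exponent of \<open>a i\<close> is divisible by the order of \<open>a i\<close>
(\<open>ord_gen_dvd_count\<close>). This makes \<open>\<epsilon>\<close> well defined, and it gives the identity
\<open>\<epsilon>(g) = \<Sum> \<epsilon>(g|\<^sub>x)\<close> (\<open>finprod_eps_psi\<close>) on which the description of the level stabilizer rests.

Let \<open>J \<le> G\<close>. The alphabet has at least three letters, and the commutator of \<open>(g at p, g\<^sup>-\<^sup>1 at q)\<close> and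
\<open>(h at p, h\<^sup>-\<^sup>1 at r)\<close> is \<open>[g,h]\<close> at \<open>p\<close> (\<open>commutator_balanced\<close>). Hence every tuple over \<open>G'\<close> is the
tuple of sections of an element of \<open>G'\<close>. Modulo such tuples and the generators of \<open>J\<close>, a tuple of
elements of \<open>G\<close> can be pushed into a single coordinate, so whether it belongs to \<open>G\<close> depends only on its
total exponent (\<open>node_in_hanoi_if_eps_one\<close>), and an exponent vector is realised by an element with
trivial root permutation exactly when \<open>\<lambda>\<close> kills it (\<open>node_in_hanoi_iff\<close>). For a tuple with one
nontrivial entry the condition reads that the entry lies in \<open>B\<close>, and since such a tuple has a trivial
root permutation, this passes down the tree and describes all rigid stabilizers (\<open>plant_in_hanoi_iff\<close>).

For just infiniteness, \<open>J\<close> even lies in \<open>G'\<close> (\<open>balanced_in_derived\<close>). A nontrivial normal subgroup \<open>N\<close>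
moves a vertex, hence all vertices of some level, and a commutator argument puts into \<open>N\<close> the copies
below such a vertex of all commutators of elements of \<open>G'\<close>. Commutators of elements of \<open>J\<close> are among
these, so \<open>N\<close> contains all copies of \<open>G'\<close> one level further down, which together have finite index.

For the finite criterion, taking the exponents of the first-level sections is a homomorphism whose kernel
consists of the tuples over \<open>G'\<close>. If \<open>G\<close> is regular branch over \<open>G'\<close>, this kernel lies in \<open>G\<close>, so
containment in \<open>G\<close> can be tested on images.
\<close>

section \<open>Automorphisms of the rooted tree\<close>

abbreviation tree_mult (infixl "\<star>" 70) where
  "g \<star> h \<equiv> g \<otimes>\<^bsub>tree_Aut\<^esub> h"

abbreviation tree_inv where
  "tree_inv g \<equiv> inv\<^bsub>tree_Aut\<^esub> g"

lemma carrier_tree_Aut [simp]: "carrier tree_Aut = tree_auts"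
  and one_tree_Aut [simp]: "\<one>\<^bsub>tree_Aut\<^esub> = id"
  and mult_tree_Aut: "g \<star> h = h \<circ> g"
  by (simp_all add: tree_Aut_def Sym_right_def)

lemma tree_mult_apply [simp]: "(g \<star> h) w = h (g w)"
  by (simp add: mult_tree_Aut)

lemma id_tree_mult [simp]: "id \<star> g = g" "g \<star> id = g"
  by (simp_all add: mult_tree_Aut)

lemma id_in_tree_auts [simp]: "id \<in> tree_auts"
  by (simp add: tree_auts_def)

text \<open>
Injectivity comes for free: two words with the same image are prefixes of each other.
\<close>

lemma tree_autsI:
  assumes "\<And>u v. prefix (g u) (g v) \<longleftrightarrow> prefix u v" and "\<And>w. \<exists>v. g v = w"
  shows "g \<in> tree_auts"
proof -
  have "inj g"
    using assms(1) by (intro injI) (metis prefix_order.antisym prefix_order.refl)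
  moreover have "surj g"
    using assms(2) by (metis surjI)
  ultimately show ?thesis
    using assms(1) by (simp add: tree_auts_def bij_def)
qed

lemma bij_tree_aut: "g \<in> tree_auts \<Longrightarrow> bij g"
  by (simp add: tree_auts_def)

lemma prefix_tree_aut [simp]: "g \<in> tree_auts \<Longrightarrow> prefix (g u) (g v) \<longleftrightarrow> prefix u v"
  by (simp add: tree_auts_def)

lemma tree_aut_surj: "g \<in> tree_auts \<Longrightarrow> \<exists>v. g v = w"
  unfolding tree_auts_def bij_iff by blast

lemma tree_aut_inj: "g \<in> tree_auts \<Longrightarrow> g u = g v \<longleftrightarrow> u = v"
  by (metis prefix_order.antisym prefix_order.refl prefix_tree_aut)

lemma group_tree_Aut: "group tree_Aut"
proof (rule groupI; simp)
  fix g h :: "'a list \<Rightarrow> 'a list" assume "g \<in> tree_auts" "h \<in> tree_auts"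
  then show "g \<star> h \<in> tree_auts"
    by (intro tree_autsI) (auto, metis tree_aut_surj)
next
  fix g h k :: "'a list \<Rightarrow> 'a list" show "g \<star> h \<star> k = g \<star> (h \<star> k)"
    by (simp add: mult_tree_Aut comp_assoc)
next
  fix g :: "'a list \<Rightarrow> 'a list" assume g: "g \<in> tree_auts"
  then have bij: "bij g" by (rule bij_tree_aut)
  have "inv_into UNIV g \<in> tree_auts"
  proof (rule tree_autsI)
    fix u v
    show "prefix (inv_into UNIV g u) (inv_into UNIV g v) = prefix u v"
      by (metis bij bij_inv_eq_iff g prefix_tree_aut)
  next
    fix w show "\<exists>v. inv_into UNIV g v = w"
      by (metis bij bij_inv_eq_iff)
  qed
  moreover have "inv_into UNIV g \<star> g = id"
    using bij by (auto simp: fun_eq_iff bij_is_surj surj_f_inv_f)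
  ultimately show "\<exists>h\<in>tree_auts. h \<star> g = id" by blast
qed

interpretation T: group tree_Aut
  by (rule group_tree_Aut)

lemma tree_mult_closed [simp, intro]: "g \<in> tree_auts \<Longrightarrow> h \<in> tree_auts \<Longrightarrow> g \<star> h \<in> tree_auts"
  using T.m_closed by simp

lemma tree_inv_closed [simp, intro]: "g \<in> tree_auts \<Longrightarrow> tree_inv g \<in> tree_auts"
  using T.inv_closed by simp

lemma tree_mult_assoc: "g \<star> h \<star> k = g \<star> (h \<star> k)"
  by (simp add: mult_tree_Aut comp_assoc)

lemma tree_inv_mult [simp]:
  assumes "g \<in> tree_auts"
  shows "tree_inv g \<star> g = id" "g \<star> tree_inv g = id"
    "tree_inv g \<star> (g \<star> h) = h" "g \<star> (tree_inv g \<star> h) = h"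
  using assms T.l_inv T.r_inv by (simp_all flip: tree_mult_assoc)

lemma tree_inv_id [simp]: "tree_inv id = id"
  using T.inv_one by simp

lemma tree_inv_apply [simp]:
  "g \<in> tree_auts \<Longrightarrow> g (tree_inv g w) = w"
  "g \<in> tree_auts \<Longrightarrow> tree_inv g (g w) = w"
  by (metis id_apply tree_inv_mult(1) tree_mult_apply) (metis id_apply tree_inv_mult(2) tree_mult_apply)

text \<open>
The length of a word is determined by its number of prefixes, and an automorphism maps the prefixes of a
word bijectively to the prefixes of its image.
\<close>

lemma length_tree_aut [simp]:
  assumes "g \<in> tree_auts" shows "length (g v) = length v"
proof -
  have "g ` set (prefixes v) = set (prefixes (g v))"
  proof (intro subset_antisym subsetI)
    fix w assume "w \<in> set (prefixes (g v))"
    then show "w \<in> g ` set (prefixes v)"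
      using assms by (metis image_eqI in_set_prefixes prefix_tree_aut tree_aut_surj)
  qed (use assms in auto)
  moreover have "inj_on g (set (prefixes v))"
    using assms by (simp add: inj_on_def tree_aut_inj)
  ultimately have "card (set (prefixes v)) = card (set (prefixes (g v)))"
    by (metis card_image)
  then show ?thesis by simp
qed

lemma tree_aut_Nil [simp]: "g \<in> tree_auts \<Longrightarrow> g [] = []"
  by (metis length_0_conv length_tree_aut)

lemma tree_aut_append:
  assumes "g \<in> tree_auts" shows "g (v @ w) = g v @ tree_section g v w"
proof -
  have "prefix (g v) (g (v @ w))" using assms by simp
  then obtain z where "g (v @ w) = g v @ z" by (rule prefixE)
  then show ?thesis using assms by (simp add: tree_section_def)
qed

lemma tree_aut_Cons:
  assumes "g \<in> tree_auts" shows "g (x # w) = root_perm g x # psi g x w"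
proof -
  obtain y where "g [x] = [y]"
    using length_tree_aut[OF assms, of "[x]"] by (metis One_nat_def length_0_conv length_Cons length_Suc_conv)
  then show ?thesis
    using tree_aut_append[OF assms, of "[x]" w] by (simp add: root_perm_def psi_def)
qed

lemma tree_section_closed [simp]:
  assumes "g \<in> tree_auts" shows "tree_section g v \<in> tree_auts"
proof (rule tree_autsI)
  fix u w
  have "prefix (g (v @ u)) (g (v @ w)) = prefix u w" using assms by simp
  then show "prefix (tree_section g v u) (tree_section g v w) = prefix u w"
    using assms by (simp add: tree_aut_append)
next
  fix w
  obtain z where z: "g z = g v @ w" using assms tree_aut_surj by blast
  then have "prefix v z" using prefix_tree_aut[OF assms, of v z] by simp
  then obtain y where "z = v @ y" by (rule prefixE)
  then show "\<exists>y. tree_section g v y = w"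
    using z assms by (auto simp: tree_aut_append)
qed

lemma psi_closed [simp]: "g \<in> tree_auts \<Longrightarrow> psi g x \<in> tree_auts"
  by (simp add: psi_def)

lemma tree_section_eqI:
  assumes "g \<in> tree_auts" "\<And>w. g (v @ w) = u @ h w" "length u = length v"
  shows "tree_section g v = h"
  using assms by (simp add: tree_section_def fun_eq_iff)

lemma tree_section_mult:
  assumes "g \<in> tree_auts" "h \<in> tree_auts"
  shows "tree_section (g \<star> h) v = tree_section g v \<star> tree_section h (g v)"
  using assms by (intro tree_section_eqI[where u = "h (g v)"]) (auto simp: tree_aut_append)

lemma tree_section_Cons: "tree_section g (x # v) = tree_section (psi g x) v"
  by (rule ext) (simp add: psi_def tree_section_def)

lemma root_perm_mult [simp]:
  "g \<in> tree_auts \<Longrightarrow> h \<in> tree_auts \<Longrightarrow> root_perm (g \<star> h) = root_perm h \<circ> root_perm g"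
  by (auto simp: root_perm_def[of "g \<star> h"] tree_aut_Cons)

lemma psi_mult:
  "g \<in> tree_auts \<Longrightarrow> h \<in> tree_auts \<Longrightarrow> psi (g \<star> h) x = psi g x \<star> psi h (root_perm g x)"
  by (simp add: psi_def tree_section_mult tree_aut_Cons[of g x "[]"])

lemma root_perm_id [simp]: "root_perm id = id"
  by (simp add: root_perm_def fun_eq_iff)

lemma psi_id [simp]: "psi id x = id"
  by (simp add: psi_def tree_section_def fun_eq_iff)

lemma bij_root_perm:
  assumes "g \<in> tree_auts" shows "bij (root_perm g)"
proof (rule o_bij)
  show "root_perm (tree_inv g) \<circ> root_perm g = id"
    using assms by (simp flip: root_perm_mult)
  show "root_perm g \<circ> root_perm (tree_inv g) = id"
    using assms by (simp flip: root_perm_mult)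
qed

section \<open>Automorphisms given by their sections\<close>

text \<open>
The inverse of the decomposition \<open>\<psi>(g) = (g|\<^sub>1, \<dots>, g|\<^sub>d)\<tau>\<close>: the automorphism with first-level
sections \<open>f\<close> and root permutation \<open>s\<close>.
\<close>

definition node :: "('x \<Rightarrow> 'x list \<Rightarrow> 'x list) \<Rightarrow> ('x \<Rightarrow> 'x) \<Rightarrow> 'x list \<Rightarrow> 'x list" where
  "node f s = (\<lambda>w. case w of [] \<Rightarrow> [] | x # u \<Rightarrow> s x # f x u)"

lemma node_simps [simp]: "node f s [] = []" "node f s (x # u) = s x # f x u"
  by (simp_all add: node_def)

lemma node_closed [simp]:
  assumes "\<And>x. f x \<in> tree_auts" "bij s" shows "node f s \<in> tree_auts"
proof (rule tree_autsI)
  fix u v show "prefix (node f s u) (node f s v) = prefix u v"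
    using assms by (cases u; cases v) (auto simp: bij_is_inj inj_eq)
next
  fix w show "\<exists>v. node f s v = w"
  proof (cases w)
    case Nil then show ?thesis by (intro exI[of _ "[]"]) simp
  next
    case (Cons y z)
    obtain x where x: "s x = y" using assms(2) by (metis bij_pointE)
    obtain v where "f x v = z" using assms(1) tree_aut_surj by blast
    then show ?thesis using Cons x by (intro exI[of _ "x # v"]) simp
  qed
qed

lemma psi_node [simp]: "psi (node f s) = f"
  and root_perm_node [simp]: "root_perm (node f s) = s"
  by (simp_all add: psi_def tree_section_def root_perm_def fun_eq_iff)

lemma node_psi: "g \<in> tree_auts \<Longrightarrow> node (psi g) (root_perm g) = g"
  by (rule ext) (auto simp: tree_aut_Cons node_def split: list.splits)

lemma tree_aut_eqI:
  assumes "g \<in> tree_auts" "h \<in> tree_auts" "root_perm g = root_perm h" "\<And>x. psi g x = psi h x"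
  shows "g = h"
proof -
  have "psi g = psi h" using assms(4) by blast
  then show ?thesis using node_psi assms(1-3) by metis
qed

lemma node_mult: "node f s \<star> node g t = node (\<lambda>x. f x \<star> g (s x)) (t \<circ> s)"
  by (rule ext) (simp add: node_def split: list.splits)

lemma node_id [simp]: "node (\<lambda>x. id) id = id"
  by (rule ext) (simp add: node_def split: list.splits)

lemma psi_inv:
  assumes "g \<in> tree_auts"
  shows "psi (tree_inv g) (root_perm g x) = tree_inv (psi g x)"
proof -
  have "psi g x \<star> psi (tree_inv g) (root_perm g x) = id"
    using assms by (simp flip: psi_mult)
  then show ?thesis
    using assms by (metis tree_inv_mult(3) id_tree_mult(2) psi_closed)
qed

lemma node_inv:
  assumes "\<And>x. f x \<in> tree_auts"
  shows "tree_inv (node f id) = node (\<lambda>x. tree_inv (f x)) id"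
proof -
  have "node (\<lambda>x. tree_inv (f x)) id \<star> node f id = id"
    using assms by (simp add: node_mult)
  then show ?thesis
    using assms by (intro T.inv_equality) simp_all
qed

lemma level_stab_1_iff: "g \<in> level_stab 1 \<longleftrightarrow> g \<in> tree_auts \<and> root_perm g = id"
proof -
  have "(\<forall>v\<in>level 1. g v = v) \<longleftrightarrow> (\<forall>x. g [x] = [x])"
    by (auto simp: level_def length_Suc_conv)
  then show ?thesis
    by (auto simp: level_stab_def tree_aut_Cons[of g _ "[]"] fun_eq_iff)
qed

text \<open>
The inverse of \<open>\<psi>\<^sub>n\<close>: the element of the level stabilizer whose sections at level \<open>n\<close> are given by
\<open>f\<close>. The recursion on the level lets facts about one level be iterated.
\<close>

primrec graft :: "nat \<Rightarrow> ('x list \<Rightarrow> 'x list \<Rightarrow> 'x list) \<Rightarrow> 'x list \<Rightarrow> 'x list" where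
  "graft 0 f = f []"
| "graft (Suc n) f = node (\<lambda>x. graft n (\<lambda>v. f (x # v))) id"

lemma graft_closed [simp]:
  "(\<And>v. length v = n \<Longrightarrow> f v \<in> tree_auts) \<Longrightarrow> graft n f \<in> tree_auts"
  by (induction n arbitrary: f) auto

lemma graft_append [simp]: "length v = n \<Longrightarrow> graft n f (v @ w) = v @ f v w"
  by (induction n arbitrary: f v) (auto simp: length_Suc_conv)

lemma graft_cong: "(\<And>v. length v = n \<Longrightarrow> f v = g v) \<Longrightarrow> graft n f = graft n g"
  by (induction n arbitrary: f g) (simp, metis (no_types, lifting) ext graft.simps(2) length_Cons)

lemma graft_id [simp]: "graft n (\<lambda>v. id) = id"
  by (induction n) (simp_all only: graft.simps node_id)

lemma graft_mult: "graft n f \<star> graft n g = graft n (\<lambda>v. f v \<star> g v)"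
  by (induction n arbitrary: f g) (simp_all only: graft.simps node_mult id_apply id_comp)

lemma graft_inv:
  "(\<And>v. length v = n \<Longrightarrow> f v \<in> tree_auts) \<Longrightarrow>
    tree_inv (graft n f) = graft n (\<lambda>v. tree_inv (f v))"
  by (induction n arbitrary: f) (simp_all add: node_inv)

lemma tree_section_graft [simp]: "length v = n \<Longrightarrow> tree_section (graft n f) v = f v"
  by (simp add: tree_section_def fun_eq_iff)

lemma graft_add:
  "graft n (\<lambda>v. graft m (\<lambda>w. f (v @ w))) = graft (n + m) f"
proof (induction n arbitrary: f)
  case 0 then show ?case by (simp only: graft.simps append_Nil add_0)
next
  case (Suc n)
  show ?case using Suc.IH[of "\<lambda>v. f (_ # v)"] by (simp only: graft.simps append_Cons add_Suc)
qed

lemma level_stab_short: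
  assumes "g \<in> level_stab n" "length w \<le> n" shows "g w = w"
proof -
  have g: "g \<in> tree_auts" using assms by (simp add: level_stab_def)
  let ?v = "w @ replicate (n - length w) undefined"
  have "g ?v = ?v" using assms by (auto simp: level_stab_def level_def)
  then show ?thesis using g by (simp add: tree_aut_append)
qed

lemma graft_section:
  assumes "g \<in> level_stab n" shows "graft n (tree_section g) = g"
proof -
  have g: "g \<in> tree_auts" using assms by (simp add: level_stab_def)
  show ?thesis using assms g
  proof (induction n arbitrary: g)
    case 0 then show ?case by (simp add: tree_section_def)
  next
    case (Suc n)
    have root: "root_perm g = id"
      using level_stab_short[OF Suc.prems(1), of "[_]"] by (auto simp: root_perm_def)
    have psi: "psi g x \<in> level_stab n" for x
    proof -
      have "psi g x v = v" if "length v = n" for v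
        using level_stab_short[OF Suc.prems(1), of "x # v"] that Suc.prems(2)
        by (simp add: tree_aut_Cons)
      then show ?thesis using Suc.prems by (simp add: level_stab_def level_def)
    qed
    have "graft n (\<lambda>v. tree_section g (x # v)) = psi g x" for x
      using Suc.IH[OF psi] Suc.prems(2) by (simp add: tree_section_Cons)
    then have "graft (Suc n) (tree_section g) = node (psi g) (root_perm g)"
      by (simp add: root)
    then show ?case using node_psi Suc.prems by metis
  qed
qed

text \<open>
The copy of \<open>g\<close> acting on the subtree below \<open>v\<close>; the rigid stabilizers consist of such copies.
\<close>

abbreviation plant :: "'x list \<Rightarrow> ('x list \<Rightarrow> 'x list) \<Rightarrow> 'x list \<Rightarrow> 'x list" where
  "plant v g \<equiv> graft (length v) (\<lambda>u. if u = v then g else id)"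

lemma plant_Cons: "plant (x # v) g = node (\<lambda>y. if y = x then plant v g else id) id"
proof -
  have "graft (length v) (\<lambda>u. if y # u = x # v then g else id) = (if y = x then plant v g else id)" for y
    by simp
  then show ?thesis by simp
qed

lemma plant_mult: "plant v g \<star> plant v h = plant v (g \<star> h)"
  unfolding graft_mult by (rule graft_cong) simp

lemma plant_inv: "g \<in> tree_auts \<Longrightarrow> tree_inv (plant v g) = plant v (tree_inv g)"
  by (subst graft_inv) (auto intro!: graft_cong)

lemma plant_plant: "plant v (plant w g) = plant (v @ w) g"
proof -
  have "plant v (plant w g) =
      graft (length v) (\<lambda>u. graft (length w) (\<lambda>z. if u @ z = v @ w then g else id))"
    by (rule graft_cong) simp
  also have "\<dots> = graft (length v + length w) (\<lambda>u. if u = v @ w then g else id)"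
    by (rule graft_add[of "length v" "length w" "\<lambda>u. if u = v @ w then g else id"])
  finally show ?thesis by (simp only: length_append)
qed

lemma plant_single: "plant [x] g = node (\<lambda>y. if y = x then g else id) id"
  by simp

lemma plant_outside: "\<not> prefix u w \<Longrightarrow> plant u g w = w"
proof (induction u arbitrary: w)
  case (Cons x u)
  show ?case
  proof (cases w)
    case (Cons y v)
    then show ?thesis using Cons.IH[of v] Cons.prems by (simp only: plant_Cons node_simps) auto
  qed simp
qed simp

text \<open>
A tuple is the finite product of its single entries, so membership can be tested vertex by vertex.
\<close>

lemma graft_in_subgroup:
  fixes f :: "'x::finite list \<Rightarrow> 'x list \<Rightarrow> 'x list"
  assumes "subgroup H tree_Aut" and "\<And>v. length v = n \<Longrightarrow> plant v (f v) \<in> H"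
  shows "graft n f \<in> H"
proof -
  have fin: "finite {v :: 'x list. length v = n}"
    using finite_lists_length_eq[of "UNIV :: 'x set" n] by simp
  have "graft n (\<lambda>v. if v \<in> S then f v else id) \<in> H" if "finite S" "S \<subseteq> {v. length v = n}" for S
    using that
  proof (induction S)
    case empty
    have "graft n (\<lambda>v :: 'x list. id) \<in> H"
      using subgroup.one_closed[OF assms(1)] by (simp only: graft_id one_tree_Aut)
    then show ?case by (simp only: empty_iff if_False)
  next
    case (insert v S)
    have "plant v (f v) \<star> graft n (\<lambda>u. if u \<in> S then f u else id) =
        graft n (\<lambda>u. (if u = v then f v else id) \<star> (if u \<in> S then f u else id))"
      using insert.prems by (simp add: graft_mult)
    also have "\<dots> = graft n (\<lambda>u. if u \<in> insert v S then f u else id)"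
      using insert.hyps by (intro graft_cong) auto
    finally show ?case
      using subgroup.m_closed[OF assms(1) assms(2)[of v] insert.IH] insert.prems by simp
  qed
  from this[OF fin subset_refl] show ?thesis
    using graft_cong[of n "\<lambda>v. if v \<in> {v. length v = n} then f v else id" f] by simp
qed

lemma tree_section_inv:
  assumes "g \<in> tree_auts"
  shows "tree_section (tree_inv g) (g v) = tree_inv (tree_section g v)"
proof -
  have "tree_section g v \<star> tree_section (tree_inv g) (g v) = tree_section (g \<star> tree_inv g) v"
    using assms by (simp only: tree_section_mult tree_inv_closed)
  also have "\<dots> = id" using assms by (simp add: tree_section_def fun_eq_iff)
  finally show ?thesis
    using assms by (metis tree_inv_mult(3) id_tree_mult(2) tree_section_closed)
qed

text \<open>
The tuples of sections of the generators of \<open>J\<close>.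
\<close>

definition balanced :: "'x \<Rightarrow> 'x \<Rightarrow> ('x list \<Rightarrow> 'x list) \<Rightarrow> 'x \<Rightarrow> 'x list \<Rightarrow> 'x list" where
  "balanced p q h = (\<lambda>x. if x = p then h else if x = q then tree_inv h else id)"

lemma balanced_closed [simp]: "h \<in> tree_auts \<Longrightarrow> balanced p q h x \<in> tree_auts"
  by (simp add: balanced_def)

text \<open>
Two such tuples share only the coordinate \<open>p\<close>, so every other coordinate of their commutator is trivial.
This is how \<open>J\<close> produces commutators in a single coordinate.
\<close>

lemma commutator_balanced:
  assumes "g \<in> tree_auts" "h \<in> tree_auts" "q \<noteq> p" "r \<noteq> p" "r \<noteq> q"
  shows "node (balanced p q g) id \<star> node (balanced p r h) id \<star>
      tree_inv (node (balanced p q g) id) \<star> tree_inv (node (balanced p r h) id) =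
    plant [p] (g \<star> h \<star> tree_inv g \<star> tree_inv h)"
proof -
  have "(\<lambda>x. balanced p q g x \<star> balanced p r h x \<star> tree_inv (balanced p q g x) \<star> tree_inv (balanced p r h x)) =
      (\<lambda>x. if x = p then g \<star> h \<star> tree_inv g \<star> tree_inv h else id)"
    using assms by (auto simp: balanced_def fun_eq_iff)
  then show ?thesis
    using assms(1,2) by (simp add: node_inv node_mult plant_single)
qed

section \<open>Permutations of the alphabet\<close>

lemma Sym_right_simps [simp]:
  "carrier Sym_right = {f. bij f}" "\<one>\<^bsub>Sym_right\<^esub> = id" "s \<otimes>\<^bsub>Sym_right\<^esub> t = t \<circ> s"
  by (simp_all add: Sym_right_def)

lemma group_Sym_right: "group Sym_right"
proof (rule groupI; simp)
  fix s t :: "'a \<Rightarrow> 'a" assume "bij s" "bij t" then show "bij (t \<circ> s)" by (rule bij_comp)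
next
  fix r s t :: "'a \<Rightarrow> 'a" show "t \<circ> (s \<circ> r) = t \<circ> s \<circ> r" by (simp add: comp_assoc)
next
  fix s :: "'a \<Rightarrow> 'a" assume "bij s"
  then show "\<exists>t. bij t \<and> s \<circ> t = id"
    by (intro exI[of _ "inv_into UNIV s"])
       (simp add: bij_imp_bij_inv bij_is_surj surj_iff[symmetric])
qed

interpretation S: group Sym_right
  by (rule group_Sym_right)

interpretation R: group_hom tree_Aut Sym_right root_perm
  by unfold_locales (simp_all add: hom_def bij_root_perm)

lemma root_perm_inv: "g \<in> tree_auts \<Longrightarrow> root_perm (tree_inv g) = inv\<^bsub>Sym_right\<^esub> (root_perm g)"
  using R.hom_inv by simp

lemma count_list_replicate: "count_list (replicate n x) y = (if x = y then n else 0)"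
  by (induction n) auto

section \<open>The generators of a spinal Hanoi towers group\<close>

locale spinal =
  fixes \<sigma> :: "'x::finite \<Rightarrow> 'x \<Rightarrow> 'x"
  assumes spinal_perms: "spinal_perms \<sigma>"
begin

abbreviation a where "a \<equiv> spinal_gen \<sigma>"
abbreviation G where "G \<equiv> hanoi_group \<sigma>"
abbreviation G' where "G' \<equiv> hanoi_derived \<sigma>"
abbreviation ord_gen where "ord_gen i \<equiv> T.ord (a i)"
abbreviation E where "E \<equiv> exp_group \<sigma>"
abbreviation eps' where "eps' \<equiv> eps \<sigma>"

lemma bij_sigma [simp]: "bij (\<sigma> i)" and sigma_neq_id: "\<sigma> i \<noteq> id" and sigma_fixed [simp]: "\<sigma> i i = i"
  using spinal_perms by (auto simp: spinal_perms_def)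

lemma sigma_eq_iff [simp]: "\<sigma> i x = \<sigma> i y \<longleftrightarrow> x = y"
  using bij_sigma by (metis bij_pointE)

lemma sigma_eq_fixed_iff [simp]: "\<sigma> i x = i \<longleftrightarrow> x = i" "i = \<sigma> i x \<longleftrightarrow> x = i"
  using sigma_eq_iff[of i x i] by auto

lemma gen_closed [simp]: "a i \<in> tree_auts"
proof (rule tree_autsI)
  fix u v show "prefix (a i u) (a i v) = prefix u v"
    by (induction u arbitrary: v; case_tac v) auto
next
  fix w show "\<exists>v. a i v = w"
  proof (induction w)
    case Nil then show ?case by (intro exI[of _ "[]"]) simp
  next
    case (Cons y w)
    then obtain v where v: "a i v = w" by blast
    obtain x where x: "\<sigma> i x = y" using bij_sigma by (metis bij_pointE)
    show ?case
      by (intro exI[of _ "x # (if x = i then v else w)"]) (simp add: v x)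
  qed
qed

lemma psi_gen [simp]: "psi (a i) x = (if x = i then a i else id)"
  by (simp add: psi_spinal_gen)

lemma root_perm_gen [simp]: "root_perm (a i) = \<sigma> i"
  by (rule root_perm_spinal_gen)

lemma root_perm_gen_pow: "root_perm (a i [^]\<^bsub>tree_Aut\<^esub> n) = \<sigma> i [^]\<^bsub>Sym_right\<^esub> (n::nat)"
  using R.hom_nat_pow[of "a i" n] by simp

lemma gen_pow_closed [simp]: "a i [^]\<^bsub>tree_Aut\<^esub> (n::nat) \<in> tree_auts"
  using T.nat_pow_closed[of "a i" n] by simp

lemma root_perm_gen_pow_fixed: "root_perm (a i [^]\<^bsub>tree_Aut\<^esub> (n::nat)) x = i \<longleftrightarrow> x = i"
proof (induction n)
  case 0
  show "root_perm (a i [^]\<^bsub>tree_Aut\<^esub> (0::nat)) x = i \<longleftrightarrow> x = i" by simp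
next
  case (Suc n)
  then show "root_perm (a i [^]\<^bsub>tree_Aut\<^esub> Suc n) x = i \<longleftrightarrow> x = i" by simp
qed

lemma psi_gen_pow:
  "psi (a i [^]\<^bsub>tree_Aut\<^esub> n) x = (if x = i then a i [^]\<^bsub>tree_Aut\<^esub> (n::nat) else id)"
proof (induction n)
  case 0
  show "psi (a i [^]\<^bsub>tree_Aut\<^esub> (0::nat)) x = (if x = i then a i [^]\<^bsub>tree_Aut\<^esub> (0::nat) else id)"
    by simp
next
  case (Suc n)
  have "psi (a i [^]\<^bsub>tree_Aut\<^esub> n) x = (if x = i then a i [^]\<^bsub>tree_Aut\<^esub> n else id)"
    by (rule Suc)
  then show "psi (a i [^]\<^bsub>tree_Aut\<^esub> Suc n) x = (if x = i then a i [^]\<^bsub>tree_Aut\<^esub> Suc n else id)"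
    by (simp add: psi_mult root_perm_gen_pow_fixed)
qed

text \<open>
The only nontrivial section of a power of \<open>a i\<close> is again that power, so it acts trivially on the tree as
soon as its root permutation is trivial.
\<close>

lemma gen_pow_eq_id:
  assumes "\<sigma> i [^]\<^bsub>Sym_right\<^esub> (n::nat) = id"
  shows "a i [^]\<^bsub>tree_Aut\<^esub> n = id"
proof
  fix w show "(a i [^]\<^bsub>tree_Aut\<^esub> n) w = id w"
  proof (induction w)
    case (Cons x w)
    then show ?case using assms by (simp add: tree_aut_Cons root_perm_gen_pow psi_gen_pow)
  qed simp
qed

text \<open>
An order \<open>0\<close> would stand for infinite order and turn a factor of \<open>exp_group \<sigma>\<close> into the integers; it is
excluded because the order of \<open>\<sigma> i\<close> is positive. An order \<open>1\<close> would make \<open>\<sigma> i\<close> trivial.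
\<close>

lemma ord_gen_ge_2: "ord_gen i \<ge> 2"
proof -
  have "S.ord (\<sigma> i) \<ge> 1"
    by (rule S.ord_ge_1) simp_all
  moreover have "a i [^]\<^bsub>tree_Aut\<^esub> S.ord (\<sigma> i) = id"
    by (rule gen_pow_eq_id) (use S.pow_ord_eq_1[of "\<sigma> i"] in simp)
  then have "ord_gen i dvd S.ord (\<sigma> i)"
    using T.pow_eq_id[of "a i"] by simp
  ultimately have "ord_gen i \<noteq> 0" by auto
  moreover have "a i \<noteq> id"
    using sigma_neq_id root_perm_gen[of i] by (metis root_perm_id)
  then have "ord_gen i \<noteq> 1"
    using T.ord_eq_1[of "a i"] by simp
  ultimately show ?thesis by linarith
qed

lemma ord_gen_pos [simp]: "ord_gen i > 0"
  using ord_gen_ge_2[of i] by linarith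

lemma one_mod_ord_gen [simp]: "1 mod int (ord_gen i) = 1"
  using ord_gen_ge_2[of i] by simp

text \<open>
A nontrivial permutation fixing a letter moves two others.
\<close>

lemma exists_third_letter:
  fixes p q :: 'x obtains r where "r \<noteq> p" "r \<noteq> q"
proof -
  obtain y where y: "\<sigma> p y \<noteq> y" using sigma_neq_id[of p] by (metis eq_id_iff)
  then have "y \<noteq> p" "\<sigma> p y \<noteq> p" by auto
  then show ?thesis using y that by metis
qed

section \<open>Words in the generators\<close>

text \<open>
Words need no inverse letters because the generators have finite order.
\<close>

primrec word_aut :: "'x list \<Rightarrow> 'x list \<Rightarrow> 'x list" where
  "word_aut [] = id"
| "word_aut (i # w) = a i \<star> word_aut w"

text \<open>
The letters of the word that are read into the section at \<open>x\<close>: those met while the image of \<open>x\<close> is the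
letter itself.
\<close>

primrec section_word :: "'x list \<Rightarrow> 'x \<Rightarrow> 'x list" where
  "section_word [] x = []"
| "section_word (i # w) x = (if x = i then i # section_word w x else section_word w (\<sigma> i x))"

lemma word_aut_closed [simp]: "word_aut w \<in> tree_auts"
proof (induction w)
  case Nil show "word_aut [] \<in> tree_auts" by simp
next
  case (Cons i w) then show "word_aut (i # w) \<in> tree_auts" by simp
qed

lemma word_aut_append: "word_aut (u @ v) = word_aut u \<star> word_aut v"
  by (induction u) (simp_all add: tree_mult_assoc)

lemma word_aut_replicate: "word_aut (replicate n i) = a i [^]\<^bsub>tree_Aut\<^esub> n"
  by (induction n) (use T.nat_pow_Suc2[of "a i"] in simp_all)

lemma psi_word_aut: "psi (word_aut w) x = word_aut (section_word w x)"
  by (induction w arbitrary: x) (simp_all add: psi_mult)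

lemma subgroup_hanoi: "subgroup G tree_Aut"
  unfolding hanoi_group_def by (rule T.generate_is_subgroup) auto

lemma hanoi_closed [simp]: "g \<in> G \<Longrightarrow> g \<in> tree_auts"
  using subgroup.subset[OF subgroup_hanoi] by auto

lemma id_in_hanoi [simp]: "id \<in> G"
  using subgroup.one_closed[OF subgroup_hanoi] by simp

lemma mult_in_hanoi [simp]: "g \<in> G \<Longrightarrow> h \<in> G \<Longrightarrow> g \<star> h \<in> G"
  using subgroup.m_closed[OF subgroup_hanoi] by simp

lemma inv_in_hanoi [simp]: "g \<in> G \<Longrightarrow> tree_inv g \<in> G"
  using subgroup.m_inv_closed[OF subgroup_hanoi] by simp

lemma gen_in_hanoi [simp]: "a i \<in> G"
  unfolding hanoi_group_def by (rule generate.incl) simp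

lemma word_aut_in_hanoi [simp]: "word_aut w \<in> G"
proof (induction w)
  case Nil show "word_aut [] \<in> G" by simp
next
  case (Cons i w) then show "word_aut (i # w) \<in> G" by simp
qed

lemma hanoi_word:
  assumes "g \<in> G" obtains w where "g = word_aut w"
proof -
  from assms have "g \<in> range word_aut"
    unfolding hanoi_group_def
  proof (induction rule: generate.induct)
    case one
    show ?case using word_aut.simps(1) by (metis one_tree_Aut rangeI)
  next
    case (incl h)
    then obtain i where "h = a i" by blast
    then have "h = word_aut [i]" by simp
    then show ?case by blast
  next
    case (inv h)
    then obtain i where h: "h = a i" by blast
    obtain n where n: "ord_gen i = Suc n"
      using ord_gen_pos[of i] gr0_implies_Suc by blast
    \<comment> \<open>The inverse of a generator is its power with exponent one less than the order.\<close>
    have "a i [^]\<^bsub>tree_Aut\<^esub> n \<star> a i = id"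
      using T.pow_ord_eq_1[of "a i"] by (simp add: n)
    then have "tree_inv h = word_aut (replicate n i)"
      unfolding h word_aut_replicate by (intro T.inv_equality) simp_all
    then show ?case by blast
  next
    case (eng g h)
    then obtain u v where "g = word_aut u" "h = word_aut v" by blast
    then have "g \<star> h = word_aut (u @ v)" by (simp add: word_aut_append)
    then show ?case by blast
  qed
  then show ?thesis using that by blast
qed

lemma hanoi_self_similar: "self_similar G"
proof -
  have "tree_section g v \<in> G" if "g \<in> G" for g v
    using that
  proof (induction v arbitrary: g)
    case Nil then show ?case by (simp add: tree_section_def)
  next
    case (Cons x v)
    obtain w where "g = word_aut w" using Cons.prems by (rule hanoi_word)
    then have "psi g x \<in> G" by (simp add: psi_word_aut)
    then show ?case using Cons.IH by (simp add: tree_section_Cons)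
  qed
  then show ?thesis by (simp add: self_similar_def)
qed

lemma section_in_hanoi [simp]: "g \<in> G \<Longrightarrow> tree_section g v \<in> G"
  using hanoi_self_similar by (simp add: self_similar_def)

lemma psi_in_hanoi [simp]: "g \<in> G \<Longrightarrow> psi g x \<in> G"
  by (simp add: psi_def)

section \<open>The exponent homomorphism\<close>

text \<open>
Each letter goes to exactly one section. In the induction step the sections of the remaining word are
only permuted by \<open>\<sigma> i\<close>.
\<close>

lemma sum_count_section_word:
  "(\<Sum>x\<in>UNIV. count_list (section_word w x) j) = count_list w j"
proof (induction w)
  case (Cons i w)
  have "(\<Sum>x\<in>UNIV. count_list (section_word (i # w) x) j) =
      (\<Sum>x\<in>UNIV. (if x = i then if i = j then 1 else 0 else 0) + count_list (section_word w (\<sigma> i x)) j)"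
    by (rule sum.cong) auto
  also have "\<dots> = (if i = j then 1 else 0) + (\<Sum>x\<in>UNIV. count_list (section_word w (\<sigma> i x)) j)"
    by (simp add: sum.distrib)
  also have "(\<Sum>x\<in>UNIV. count_list (section_word w (\<sigma> i x)) j) = (\<Sum>x\<in>UNIV. count_list (section_word w x) j)"
    using bij_sigma by (rule sum.reindex_bij_betw)
  finally show ?case using Cons.IH by simp
qed simp

lemma length_section_word_le: "length (section_word w x) \<le> length w"
  by (induction w arbitrary: x) (auto simp: le_SucI)

text \<open>
A section keeps the whole word only if the letter \<open>x\<close> is met at every step, and then \<open>x\<close> is never moved.
\<close>

lemma length_section_word_eq:
  "length (section_word w x) = length w \<Longrightarrow> w = replicate (length w) x"
proof (induction w)
  case (Cons i w)
  show ?case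
  proof (cases "x = i")
    case True
    then show ?thesis using Cons by simp
  next
    case False
    then show ?thesis using Cons.prems length_section_word_le[of w "\<sigma> i x"] by simp
  qed
qed simp

text \<open>
The divisibility holds for the sections by induction on the length, and exponents add up over the
sections. The one case in which the length does not drop is a power of a single generator, where it holds
by definition of the order.
\<close>

lemma ord_gen_dvd_count:
  "word_aut w = id \<Longrightarrow> ord_gen j dvd count_list w j"
proof (induction w rule: length_induct)
  case (1 w)
  have trivial: "word_aut w = id" by (rule 1(2))
  show ?case
  proof (cases "\<exists>x. length (section_word w x) = length w")
    case True
    then obtain x where x: "w = replicate (length w) x" using length_section_word_eq by blast
    then have "a x [^]\<^bsub>tree_Aut\<^esub> length w = id"
      using trivial word_aut_replicate[of "length w" x] by simp
    then have "ord_gen x dvd length w"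
      using T.pow_eq_id[of "a x"] by simp
    moreover have "count_list w j = (if x = j then length w else 0)"
      using count_list_replicate x by metis
    ultimately show ?thesis by (cases "x = j") simp_all
  next
    case False
    have "ord_gen j dvd count_list (section_word w x) j" for x
    proof -
      have "length (section_word w x) < length w"
        using False length_section_word_le[of w x] by (metis le_neq_implies_less)
      moreover have "word_aut (section_word w x) = id"
        using trivial by (simp flip: psi_word_aut)
      ultimately show ?thesis using 1(1) by blast
    qed
    then show ?thesis
      unfolding sum_count_section_word[of w j, symmetric] by (intro dvd_sum) blast
  qed
qed

text \<open>
Appending a word for the common inverse turns both words into relations.
\<close>

lemma word_aut_exponents:
  assumes "word_aut u = word_aut v"
  shows "count_list u j mod ord_gen j = count_list v j mod ord_gen j"
proof -
  obtain w where w: "tree_inv (word_aut u) = word_aut w"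
    using hanoi_word inv_in_hanoi word_aut_in_hanoi by metis
  have "word_aut (u @ w) = id" "word_aut (v @ w) = id"
    using assms by (simp_all add: word_aut_append flip: w)
  then have "ord_gen j dvd count_list u j + count_list w j" "ord_gen j dvd count_list v j + count_list w j"
    using ord_gen_dvd_count[of _ j] by (metis count_list_append)+
  then have "(count_list u j + count_list w j) mod ord_gen j = (count_list v j + count_list w j) mod ord_gen j"
    by simp
  then have "(int (count_list u j) + int (count_list w j)) mod int (ord_gen j) =
      (int (count_list v j) + int (count_list w j)) mod int (ord_gen j)"
    by (metis of_nat_add of_nat_mod)
  then have "int (count_list u j) mod int (ord_gen j) = int (count_list v j) mod int (ord_gen j)"
    by (simp add: mod_eq_dvd_iff)
  then show ?thesis by (metis of_nat_eq_iff of_nat_mod)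
qed

lemma exp_group_simps [simp]:
  "carrier E = {f. \<forall>j. 0 \<le> f j \<and> f j < int (ord_gen j)}"
  "\<one>\<^bsub>E\<^esub> = (\<lambda>j. 0)"
  "e \<otimes>\<^bsub>E\<^esub> f = (\<lambda>j. (e j + f j) mod int (ord_gen j))"
proof -
  have "carrier (integer_mod_group (ord_gen j)) = {0..<int (ord_gen j)}" for j
    by (simp add: carrier_integer_mod_group)
  then show "carrier E = {f. \<forall>j. 0 \<le> f j \<and> f j < int (ord_gen j)}"
    by (auto simp: exp_group_def PiE_UNIV_domain Pi_iff)
qed (simp_all add: exp_group_def restrict_UNIV)

lemma comm_group_exp: "comm_group E"
proof (rule group.group_comm_groupI)
  show "group E" by (simp add: exp_group_def)
qed (simp add: add.commute)

sublocale E: comm_group E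
  by (rule comm_group_exp)

lemma inv_exp [simp]:
  assumes "e \<in> carrier E" shows "inv\<^bsub>E\<^esub> e = (\<lambda>j. (- e j) mod int (ord_gen j))"
  by (rule E.inv_equality) (use assms in \<open>auto simp: mod_add_left_eq\<close>)

lemma finprod_exp:
  assumes "finite A" "\<And>x. x \<in> A \<Longrightarrow> f x \<in> carrier E"
  shows "finprod E f A = (\<lambda>j. (\<Sum>x\<in>A. f x j) mod int (ord_gen j))"
  using assms
proof (induction A)
  case (insert x A)
  have "finprod E f (insert x A) = f x \<otimes>\<^bsub>E\<^esub> finprod E f A"
    using insert by (intro E.finprod_insert) auto
  also have "\<dots> = (\<lambda>j. (\<Sum>y\<in>insert x A. f y j) mod int (ord_gen j))"
    using insert by (simp add: mod_add_right_eq)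
  finally show ?case .
qed simp

definition word_exp :: "'x list \<Rightarrow> 'x \<Rightarrow> int" where
  "word_exp w = (\<lambda>j. int (count_list w j) mod int (ord_gen j))"

lemma word_exp_eqI:
  assumes "word_aut u = word_aut v" shows "word_exp u = word_exp v"
  unfolding word_exp_def
  by (rule ext) (use word_aut_exponents[OF assms] in \<open>simp flip: of_nat_mod\<close>)

lemma word_exp_append: "word_exp (u @ v) = word_exp u \<otimes>\<^bsub>E\<^esub> word_exp v"
  by (simp add: word_exp_def mod_add_eq)

lemma word_exp_closed: "word_exp w \<in> carrier E"
  by (simp add: word_exp_def)

lemma group_hanoi: "group (aut_group G)"
  by (rule T.subgroup_imp_group[OF subgroup_hanoi])

lemma inv_aut_group [simp]: "g \<in> G \<Longrightarrow> inv\<^bsub>aut_group G\<^esub> g = tree_inv g"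
  using T.m_inv_consistent[OF subgroup_hanoi] by simp

text \<open>
Reading off the exponents of a representing word is well defined by \<open>word_exp_eqI\<close> and satisfies the
conditions that characterise \<open>\<epsilon>\<close>; they determine a homomorphism on all words.
\<close>

lemma eps_word: "eps' (word_aut w) = word_exp w"
proof -
  let ?P = "\<lambda>f. f \<in> hom (aut_group G) E \<and> f \<in> extensional G \<and> (\<forall>i. f (a i) = std_gen i)"
  have uniq: "f (word_aut w) = word_exp w" if "?P f" for f w
  proof (induction w)
    case Nil
    have "f (\<one>\<^bsub>aut_group G\<^esub>) = \<one>\<^bsub>E\<^esub>"
      using that hom_one[of f "aut_group G" E] group_hanoi E.is_group by blast
    then show "f (word_aut []) = word_exp []" by (simp add: word_exp_def)
  next
    case (Cons i w)
    have mult: "f (a i \<star> word_aut w) = f (a i) \<otimes>\<^bsub>E\<^esub> f (word_aut w)"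
      using that hom_mult[of f "aut_group G" E "a i" "word_aut w"] by simp
    have gen: "f (a i) = word_exp [i]"
      using that by (auto simp: std_gen_def word_exp_def fun_eq_iff)
    have "f (word_aut w) = word_exp w" by (rule Cons)
    then show "f (word_aut (i # w)) = word_exp (i # w)"
      using mult word_exp_append[of "[i]" w] by (simp add: gen)
  qed
  define f where "f = restrict (\<lambda>g. word_exp (SOME w. word_aut w = g)) G"
  have f_word: "f (word_aut w) = word_exp w" for w
  proof -
    have "word_aut (SOME u. word_aut u = word_aut w) = word_aut w"
      by (rule someI) (rule refl)
    then have "word_exp (SOME u. word_aut u = word_aut w) = word_exp w"
      by (rule word_exp_eqI)
    then show ?thesis by (simp add: f_def)
  qed
  have "?P f"
  proof (intro conjI allI)
    show "f \<in> hom (aut_group G) E"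
    proof (rule homI)
      fix g assume "g \<in> carrier (aut_group G)"
      then obtain w where "g = word_aut w"
        by (auto elim!: hanoi_word)
      then show "f g \<in> carrier E"
        by (simp only: f_word word_exp_closed)
    next
      fix g h assume "g \<in> carrier (aut_group G)" "h \<in> carrier (aut_group G)"
      then obtain u v where "g = word_aut u" "h = word_aut v"
        by (auto elim!: hanoi_word)
      then show "f (g \<otimes>\<^bsub>aut_group G\<^esub> h) = f g \<otimes>\<^bsub>E\<^esub> f h"
        by (simp add: f_word word_exp_append flip: word_aut_append)
    qed
    show "f \<in> extensional G" by (simp add: f_def)
    show "f (a i) = std_gen i" for i
      using f_word[of "[i]"] by (auto simp: std_gen_def word_exp_def fun_eq_iff) 
  qed
  moreover have "g = f" if "?P g" for g
  proof
    fix h show "g h = f h"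
    proof (cases "h \<in> G")
      case True
      then obtain w where "h = word_aut w" by (rule hanoi_word)
      then show ?thesis using uniq[OF that] f_word by simp
    next
      case False
      then show ?thesis using that \<open>?P f\<close> by (metis extensional_arb)
    qed
  qed
  ultimately have "eps' = f"
    unfolding eps_def by (intro the_equality) blast+
  then show ?thesis by (simp add: f_word)
qed

lemma eps_closed: "g \<in> G \<Longrightarrow> eps' g \<in> carrier E"
  by (metis eps_word hanoi_word word_exp_closed)

lemma eps_mult: "g \<in> G \<Longrightarrow> h \<in> G \<Longrightarrow> eps' (g \<star> h) = eps' g \<otimes>\<^bsub>E\<^esub> eps' h"
  by (metis eps_word hanoi_word word_aut_append word_exp_append)

lemma eps_gen: "eps' (a i) = std_gen i"
  using eps_word[of "[i]"]
  by (auto simp: std_gen_def word_exp_def fun_eq_iff)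

sublocale eps: group_hom "aut_group G" E eps'
  by (intro group_hom.intro group_hom_axioms.intro group_hanoi E.is_group homI)
     (simp_all add: eps_mult eps_closed[simplified])

lemma eps_id [simp]: "eps' id = \<one>\<^bsub>E\<^esub>"
  using eps.hom_one by simp

lemma eps_inv: "g \<in> G \<Longrightarrow> eps' (tree_inv g) = inv\<^bsub>E\<^esub> (eps' g)"
  using eps.hom_inv[of g] by simp

text \<open>
The word lists each generator as often as its prescribed residue says.
\<close>

lemma eps_surj: assumes "c \<in> carrier E" obtains g where "g \<in> G" "eps' g = c"
proof -
  obtain xs :: "'x list" where xs: "set xs = UNIV" "distinct xs"
    using finite_distinct_list[of "UNIV :: 'x set"] by auto
  have "\<exists>w. \<forall>j. count_list w j = (if j \<in> set ys then nat (c j) else 0)" if "distinct ys" for ys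
    using that
  proof (induction ys)
    case Nil show ?case by (intro exI[of _ "[]"]) simp
  next
    case (Cons y ys)
    then obtain w where "\<forall>j. count_list w j = (if j \<in> set ys then nat (c j) else 0)" by auto
    then show ?case
      using Cons.prems
      by (intro exI[of _ "replicate (nat (c y)) y @ w"]) (auto simp: count_list_replicate)
  qed
  from this[OF xs(2)] obtain w where "\<forall>j. count_list w j = nat (c j)"
    by (auto simp: xs(1))
  then have "eps' (word_aut w) = c"
    using assms by (auto simp: eps_word word_exp_def)
  then show ?thesis using that word_aut_in_hanoi by blast
qed

text \<open>
Each letter of a representing word contributes to exactly one section. This is what ties exponents to the
level stabilizer.
\<close>

lemma finprod_eps_psi:
  assumes "g \<in> G" shows "finprod E (\<lambda>x. eps' (psi g x)) UNIV = eps' g"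
proof -
  obtain w where w: "g = word_aut w" using assms by (rule hanoi_word)
  have "finprod E (\<lambda>x. eps' (psi g x)) UNIV = (\<lambda>j. (\<Sum>x\<in>UNIV. eps' (psi g x) j) mod int (ord_gen j))"
    using assms by (intro finprod_exp eps_closed) auto
  also have "\<dots> = word_exp w"
    by (simp add: w psi_word_aut eps_word word_exp_def mod_sum_eq
        sum_count_section_word[of w, symmetric])
  finally show ?thesis by (simp add: w eps_word)
qed

section \<open>The kernel of the exponent homomorphism\<close>

lemma derived_in_hanoi: "G' \<subseteq> G"
  unfolding hanoi_derived_def by (rule T.derived_incl[OF subset_refl subgroup_hanoi])

lemma derived_closed [simp]: "g \<in> G' \<Longrightarrow> g \<in> G"
  using derived_in_hanoi by blast

lemma commutator_in_derived:
  assumes "g \<in> G" "h \<in> G" shows "g \<star> h \<star> tree_inv g \<star> tree_inv h \<in> G'"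
  unfolding hanoi_derived_def derived_def using assms by (intro generate.incl) blast

lemma subgroup_derived: "subgroup G' tree_Aut"
  unfolding hanoi_derived_def by (rule T.derived_is_subgroup) auto

lemma derived_minimal:
  assumes "subgroup H tree_Aut"
    and "\<And>g h. g \<in> G \<Longrightarrow> h \<in> G \<Longrightarrow> g \<star> h \<star> tree_inv g \<star> tree_inv h \<in> H"
  shows "G' \<subseteq> H"
  unfolding hanoi_derived_def derived_def
  by (rule T.generate_subgroup_incl[OF _ assms(1)]) (use assms(2) in auto)

lemma derived_aut_group: "derived (aut_group G) G = G'"
  unfolding hanoi_derived_def by (rule T.derived_consistent[OF subset_refl subgroup_hanoi])

lemma derived_normal: "G' \<lhd> aut_group G"
  using group.derived_self_is_normal[OF group_hanoi] by (simp add: derived_aut_group)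

lemma comm_group_ab: "comm_group (hanoi_ab \<sigma>)"
  using group.derived_quot_is_comm_group[OF group_hanoi] by (simp add: derived_aut_group)

text \<open>
Modulo the derived subgroup the letters of a word commute and can be collected.
\<close>

lemma word_coset:
  "G' #>\<^bsub>aut_group G\<^esub> word_aut w =
    (\<Otimes>\<^bsub>hanoi_ab \<sigma>\<^esub>j\<in>UNIV. (G' #>\<^bsub>aut_group G\<^esub> a j) [^]\<^bsub>hanoi_ab \<sigma>\<^esub> count_list w j)"
proof -
  interpret Q: comm_group "hanoi_ab \<sigma>" by (rule comm_group_ab)
  interpret N: normal G' "aut_group G" by (rule derived_normal)
  define c where "c j = G' #>\<^bsub>aut_group G\<^esub> a j" for j
  have c: "c j \<in> carrier (hanoi_ab \<sigma>)" for j
    by (auto simp: c_def carrier_FactGroup)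
  have "G' #>\<^bsub>aut_group G\<^esub> word_aut w = (\<Otimes>\<^bsub>hanoi_ab \<sigma>\<^esub>j\<in>UNIV. c j [^]\<^bsub>hanoi_ab \<sigma>\<^esub> count_list w j)"
  proof (induction w)
    case Nil
    have "G' #>\<^bsub>aut_group G\<^esub> id = G'"
      using eps.G.coset_mult_one[of G'] derived_in_hanoi by simp
    then show "G' #>\<^bsub>aut_group G\<^esub> word_aut [] = (\<Otimes>\<^bsub>hanoi_ab \<sigma>\<^esub>j\<in>UNIV. c j [^]\<^bsub>hanoi_ab \<sigma>\<^esub> count_list [] j)"
      using Q.finprod_one[of "UNIV :: 'x set"] by simp
  next
    case (Cons i w)
    have IH: "G' #>\<^bsub>aut_group G\<^esub> word_aut w = (\<Otimes>\<^bsub>hanoi_ab \<sigma>\<^esub>j\<in>UNIV. c j [^]\<^bsub>hanoi_ab \<sigma>\<^esub> count_list w j)"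
      by (rule Cons)
    have 1: "G' #>\<^bsub>aut_group G\<^esub> word_aut (i # w) = c i \<otimes>\<^bsub>hanoi_ab \<sigma>\<^esub> (G' #>\<^bsub>aut_group G\<^esub> word_aut w)"
      using N.rcos_sum[of "a i" "word_aut w"] by (simp add: c_def)
    have 2: "c i = (\<Otimes>\<^bsub>hanoi_ab \<sigma>\<^esub>j\<in>UNIV. if i = j then c j else \<one>\<^bsub>hanoi_ab \<sigma>\<^esub>)"
      by (rule Q.finprod_singleton[symmetric]) (use c in auto)
    have "c i \<otimes>\<^bsub>hanoi_ab \<sigma>\<^esub> (\<Otimes>\<^bsub>hanoi_ab \<sigma>\<^esub>j\<in>UNIV. c j [^]\<^bsub>hanoi_ab \<sigma>\<^esub> count_list w j) =
      (\<Otimes>\<^bsub>hanoi_ab \<sigma>\<^esub>j\<in>UNIV. (if i = j then c j else \<one>\<^bsub>hanoi_ab \<sigma>\<^esub>) \<otimes>\<^bsub>hanoi_ab \<sigma>\<^esub>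
         c j [^]\<^bsub>hanoi_ab \<sigma>\<^esub> count_list w j)"
      by (subst 2, rule Q.finprod_multf[symmetric]) (use c Q.one_closed in \<open>auto intro: Q.nat_pow_closed\<close>)
    also have "\<dots> = (\<Otimes>\<^bsub>hanoi_ab \<sigma>\<^esub>j\<in>UNIV. c j [^]\<^bsub>hanoi_ab \<sigma>\<^esub> count_list (i # w) j)"
    proof (rule Q.finprod_cong')
      fix j
      show "(if i = j then c j else \<one>\<^bsub>hanoi_ab \<sigma>\<^esub>) \<otimes>\<^bsub>hanoi_ab \<sigma>\<^esub> c j [^]\<^bsub>hanoi_ab \<sigma>\<^esub> count_list w j =
          c j [^]\<^bsub>hanoi_ab \<sigma>\<^esub> count_list (i # w) j"
        using Q.nat_pow_Suc2[OF c, of j "count_list w j"] Q.l_one[OF Q.nat_pow_closed[OF c], of j "count_list w j"]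
        by (simp del: mult_FactGroup one_FactGroup)
    qed (use c in \<open>auto intro: Q.nat_pow_closed\<close>)
    finally show "G' #>\<^bsub>aut_group G\<^esub> word_aut (i # w) = (\<Otimes>\<^bsub>hanoi_ab \<sigma>\<^esub>j\<in>UNIV. c j [^]\<^bsub>hanoi_ab \<sigma>\<^esub> count_list (i # w) j)"
      using 1 IH by simp
  qed
  then show ?thesis by (simp add: c_def)
qed

text \<open>
Commutators have exponent zero because the target is abelian. Conversely, in the collected form of a word
with exponent zero every factor is a power of a generator by a multiple of its order.
\<close>

lemma eps_eq_one_iff:
  assumes "g \<in> G" shows "eps' g = \<one>\<^bsub>E\<^esub> \<longleftrightarrow> g \<in> G'"
proof
  assume "g \<in> G'"
  moreover have "G' \<subseteq> {g \<in> G. eps' g = \<one>\<^bsub>E\<^esub>}"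
  proof (rule derived_minimal)
    show "subgroup {g \<in> G. eps' g = \<one>\<^bsub>E\<^esub>} tree_Aut"
    proof (rule T.subgroupI; safe)
      fix g h assume "g \<in> G" "eps' g = \<one>\<^bsub>E\<^esub>" 
      then show "eps' (tree_inv g) = \<one>\<^bsub>E\<^esub>" using E.inv_one by (simp only: eps_inv)
      fix h assume "h \<in> G" "eps' h = \<one>\<^bsub>E\<^esub>"
      then show "eps' (g \<star> h) = \<one>\<^bsub>E\<^esub>"
        using \<open>g \<in> G\<close> \<open>eps' g = \<one>\<^bsub>E\<^esub>\<close> by (simp only: eps_mult E.l_one[OF E.one_closed])
    next
      have "id \<in> {g \<in> G. eps' g = \<one>\<^bsub>E\<^esub>}" by simp
      then show "{g \<in> G. eps' g = \<one>\<^bsub>E\<^esub>} = {} \<Longrightarrow> False" by blast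
    qed auto
  next
    fix g h assume "g \<in> G" "h \<in> G"
    then show "g \<star> h \<star> tree_inv g \<star> tree_inv h \<in> {g \<in> G. eps' g = \<one>\<^bsub>E\<^esub>}"
      using eps_closed[of g] eps_closed[of h]
        E.m_comm[of "eps' g" "eps' h"] E.m_assoc E.inv_closed E.r_inv E.r_one E.inv_solve_right
      by (simp del: exp_group_simps inv_exp add: eps_mult eps_inv)
  qed
  ultimately show "eps' g = \<one>\<^bsub>E\<^esub>" by blast
next
  assume one: "eps' g = \<one>\<^bsub>E\<^esub>"
  obtain w where w: "g = word_aut w" using assms by (rule hanoi_word)
  interpret Q: comm_group "hanoi_ab \<sigma>" by (rule comm_group_ab)
  interpret N: normal G' "aut_group G" by (rule derived_normal)
  have "(G' #>\<^bsub>aut_group G\<^esub> a j) [^]\<^bsub>hanoi_ab \<sigma>\<^esub> count_list w j = \<one>\<^bsub>hanoi_ab \<sigma>\<^esub>" for j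
  proof -
    have "int (count_list w j) mod int (ord_gen j) = 0"
      using one by (simp add: w eps_word word_exp_def fun_eq_iff)
    then have "ord_gen j dvd count_list w j"
      by (simp add: mod_eq_0_iff_dvd)
    then have "a j [^]\<^bsub>tree_Aut\<^esub> count_list w j = id"
      using T.pow_eq_id[of "a j"] by simp
    moreover have "a j [^]\<^bsub>aut_group G\<^esub> n = a j [^]\<^bsub>tree_Aut\<^esub> n" for n :: nat
      by (simp add: nat_pow_def)
    ultimately have "(G' #>\<^bsub>aut_group G\<^esub> a j) [^]\<^bsub>hanoi_ab \<sigma>\<^esub> count_list w j = G' #>\<^bsub>aut_group G\<^esub> id"
      using N.FactGroup_pow[of "a j" "count_list w j"] by simp
    then show ?thesis
      using eps.G.coset_mult_one[of G'] derived_in_hanoi by simp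
  qed
  then have "G' #>\<^bsub>aut_group G\<^esub> g = \<one>\<^bsub>hanoi_ab \<sigma>\<^esub>"
    unfolding w word_coset using Q.finprod_one[of "UNIV :: 'x set"] by simp
  then have "G' #>\<^bsub>aut_group G\<^esub> g = G'" by simp
  then show "g \<in> G'"
    using eps.G.coset_join1[of G' g] assms N.subgroup_axioms by simp
qed

lemma eps_eq_iff:
  assumes "g \<in> G" "h \<in> G" shows "eps' g = eps' h \<longleftrightarrow> g \<star> tree_inv h \<in> G'"
proof -
  have "g \<star> tree_inv h \<in> G' \<longleftrightarrow> eps' g \<otimes>\<^bsub>E\<^esub> inv\<^bsub>E\<^esub> eps' h = \<one>\<^bsub>E\<^esub>"
    using assms by (simp only: eps_mult eps_inv inv_in_hanoi mult_in_hanoi flip: eps_eq_one_iff)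
  also have "\<dots> \<longleftrightarrow> eps' g = eps' h"
    using assms eps_closed E.inv_solve_right'[of "\<one>\<^bsub>E\<^esub>" "eps' g" "eps' h"]
    by (metis E.l_one E.one_closed E.r_inv)
  finally show ?thesis by simp
qed

section \<open>Root permutations modulo commutators\<close>

lemma root_group_eq: "root_group \<sigma> = root_perm ` G"
proof -
  have "root_perm ` range a = range \<sigma>" by (auto simp: image_def)
  then show ?thesis
    using R.generate_img[of "range a"] by (simp add: root_group_def hanoi_group_def image_subset_iff)
qed

text \<open>
Taking root permutations maps \<open>G\<close> onto the root group, hence derived subgroup onto derived subgroup.
\<close>

lemma root_derived_eq: "root_derived \<sigma> = root_perm ` G'"
  unfolding root_derived_def root_group_eq hanoi_derived_def
  by (rule R.derived_img) auto

lemma subgroup_root_group: "subgroup (root_group \<sigma>) Sym_right"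
  unfolding root_group_def by (rule S.generate_is_subgroup) auto

lemma root_group_bij: "s \<in> root_group \<sigma> \<Longrightarrow> bij s"
  using subgroup.subset[OF subgroup_root_group] by auto

lemma subgroup_root_derived: "subgroup (root_derived \<sigma>) Sym_right"
  unfolding root_derived_def by (rule S.derived_is_subgroup) (use root_group_bij in auto)

lemma derived_cosetI: "g \<in> G \<Longrightarrow> h \<in> G' #>\<^bsub>aut_group G\<^esub> g \<Longrightarrow> \<exists>d\<in>G'. h = d \<star> g"
  by (auto simp: r_coset_def)

lemma self_in_derived_coset: "g \<in> G \<Longrightarrow> g \<in> G' #>\<^bsub>aut_group G\<^esub> g"
  using group.rcos_self[OF group_hanoi, of g G'] derived_normal by (simp add: normal_imp_subgroup)

lemma eps_bar_coset:
  assumes "g \<in> G" shows "eps_bar \<sigma> (G' #>\<^bsub>aut_group G\<^esub> g) = eps' g"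
proof -
  have "eps' h = eps' g" if h: "h \<in> G' #>\<^bsub>aut_group G\<^esub> g" for h
  proof -
    obtain d where d: "d \<in> G'" "h = d \<star> g" using derived_cosetI[OF assms h] by blast
    then have "eps' d = \<one>\<^bsub>E\<^esub>" using eps_eq_one_iff derived_closed by blast
    then show ?thesis
      using d assms eps_closed[OF assms] by (simp only: eps_mult derived_closed E.l_one)
  qed
  then have "eps' ` (G' #>\<^bsub>aut_group G\<^esub> g) = {eps' g}"
    using self_in_derived_coset[OF assms] by blast
  then show ?thesis by (simp add: eps_bar_def)
qed

lemma rho_bar_coset:
  assumes "g \<in> G"
  shows "rho_bar \<sigma> (G' #>\<^bsub>aut_group G\<^esub> g) = root_derived \<sigma> #>\<^bsub>Sym_right\<^esub> root_perm g"
proof -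
  let ?f = "\<lambda>g. root_derived \<sigma> #>\<^bsub>Sym_right\<^esub> root_perm g"
  have "?f h = ?f g" if h: "h \<in> G' #>\<^bsub>aut_group G\<^esub> g" for h
  proof -
    obtain d where d: "d \<in> G'" "h = d \<star> g" using derived_cosetI[OF assms h] by blast
    have "root_perm d \<in> root_derived \<sigma>" using d by (simp add: root_derived_eq)
    then have "root_derived \<sigma> #>\<^bsub>Sym_right\<^esub> root_perm d = root_derived \<sigma>"
      using d by (intro S.coset_join2 subgroup_root_derived) (simp_all add: bij_root_perm)
    moreover have "?f h = (root_derived \<sigma> #>\<^bsub>Sym_right\<^esub> root_perm d) #>\<^bsub>Sym_right\<^esub> root_perm g"
      using d assms subgroup.subset[OF subgroup_root_derived]
      by (subst S.coset_mult_assoc) (simp_all add: bij_root_perm)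
    ultimately show ?thesis by simp
  qed
  then have "?f ` (G' #>\<^bsub>aut_group G\<^esub> g) = {?f g}"
    using self_in_derived_coset[OF assms] by blast
  then show ?thesis by (simp add: rho_bar_def)
qed

text \<open>
This identifies \<open>\<lambda>\<close> as the map induced by taking root permutations. The inverse of \<open>\<epsilon>\<close> on cosets is
computed by \<open>inv_into\<close>, so the injectivity of \<open>\<epsilon>\<close> on cosets is what is needed.
\<close>

lemma lam_eps:
  assumes "g \<in> G" shows "lam \<sigma> (eps' g) = root_derived \<sigma> #>\<^bsub>Sym_right\<^esub> root_perm g"
proof -
  have carrier: "carrier (hanoi_ab \<sigma>) = (\<lambda>g. G' #>\<^bsub>aut_group G\<^esub> g) ` G"
    by (simp add: carrier_FactGroup)
  have "inj_on (eps_bar \<sigma>) (carrier (hanoi_ab \<sigma>))"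
  proof (rule inj_onI)
    fix C D assume "C \<in> carrier (hanoi_ab \<sigma>)" "D \<in> carrier (hanoi_ab \<sigma>)" and eq: "eps_bar \<sigma> C = eps_bar \<sigma> D"
    then obtain g h where gh: "g \<in> G" "C = G' #>\<^bsub>aut_group G\<^esub> g" "h \<in> G" "D = G' #>\<^bsub>aut_group G\<^esub> h"
      by (auto simp: carrier)
    then have d: "g \<star> tree_inv h \<in> G'" using eq eps_eq_iff eps_bar_coset by metis
    then have "G' #>\<^bsub>aut_group G\<^esub> (g \<star> tree_inv h) = G'"
      using group.coset_join2[OF group_hanoi, of "g \<star> tree_inv h" G'] derived_normal
      by (simp add: normal_imp_subgroup)
    then show "C = D"
      using group.coset_mult_inv1[OF group_hanoi, of G' g h] gh derived_in_hanoi by simp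
  qed
  then have "inv_into (carrier (hanoi_ab \<sigma>)) (eps_bar \<sigma>) (eps_bar \<sigma> (G' #>\<^bsub>aut_group G\<^esub> g)) = G' #>\<^bsub>aut_group G\<^esub> g"
    using assms by (intro inv_into_f_f) (auto simp: carrier)
  then show ?thesis
    by (simp only: lam_def comp_apply eps_bar_coset[OF assms] rho_bar_coset[OF assms])
qed

lemma eps_in_kernel_iff:
  assumes "g \<in> G"
  shows "eps' g \<in> kernel E (root_ab \<sigma>) (lam \<sigma>) \<longleftrightarrow> g \<in> B_group \<sigma>"
proof -
  have "eps' g \<in> kernel E (root_ab \<sigma>) (lam \<sigma>) \<longleftrightarrow>
      root_derived \<sigma> #>\<^bsub>Sym_right\<^esub> root_perm g = root_derived \<sigma>"
    using assms eps_closed[OF assms] by (simp add: kernel_def lam_eps del: exp_group_simps)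
  also have "\<dots> \<longleftrightarrow> root_perm g \<in> root_derived \<sigma>"
    using S.coset_join1[OF _ _ subgroup_root_derived, of "root_perm g"]
      S.coset_join2[OF _ subgroup_root_derived, of "root_perm g"] assms
    by (auto simp: bij_root_perm)
  finally show ?thesis using assms by (simp add: B_group_def)
qed

section \<open>Tuples of sections\<close>

text \<open>
Lets statements about planted elements of \<open>G'\<close> be checked on commutators only.
\<close>

lemma subgroup_plant:
  assumes "subgroup H tree_Aut" shows "subgroup {d \<in> tree_auts. plant v d \<in> H} tree_Aut"
proof (rule T.subgroupI)
  have "plant v id = id" by (simp cong: if_cong)
  then have "id \<in> {d \<in> tree_auts. plant v d \<in> H}" using subgroup.one_closed[OF assms] by simp
  then show "{d \<in> tree_auts. plant v d \<in> H} \<noteq> {}" by blast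
next
  fix d assume "d \<in> {d \<in> tree_auts. plant v d \<in> H}"
  then show "tree_inv d \<in> {d \<in> tree_auts. plant v d \<in> H}"
    using subgroup.m_inv_closed[OF assms, of "plant v d"] by (auto simp only: mem_Collect_eq plant_inv tree_inv_closed)
next
  fix d e assume "d \<in> {d \<in> tree_auts. plant v d \<in> H}" "e \<in> {d \<in> tree_auts. plant v d \<in> H}"
  then show "d \<star> e \<in> {d \<in> tree_auts. plant v d \<in> H}"
    using subgroup.m_closed[OF assms, of "plant v d" "plant v e"] by (auto simp only: mem_Collect_eq plant_mult tree_mult_closed)
qed auto

text \<open>
A map with finitely many values bounds the index of any subgroup that separates its values.
\<close>

lemma finite_rcosetsI:
  assumes "subgroup N (aut_group G)" "finite (F ` G)"
    and "\<And>g h. g \<in> G \<Longrightarrow> h \<in> G \<Longrightarrow> F g = F h \<Longrightarrow> g \<star> tree_inv h \<in> N"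
  shows "finite (rcosets\<^bsub>aut_group G\<^esub> N)"
proof -
  let ?c = "\<lambda>g. N #>\<^bsub>aut_group G\<^esub> g"
  have N: "N \<subseteq> carrier (aut_group G)" using assms(1) by (rule subgroup.subset)
  have eq: "?c g = ?c h" if "g \<in> G" "h \<in> G" "F g = F h" for g h
  proof (rule eps.G.coset_mult_inv1[OF _ _ _ N])
    have "g \<star> tree_inv h \<in> N" using assms(3) that by blast
    then show "N #>\<^bsub>aut_group G\<^esub> (g \<otimes>\<^bsub>aut_group G\<^esub> inv\<^bsub>aut_group G\<^esub> h) = N"
      using eps.G.coset_join2[OF _ assms(1), of "g \<star> tree_inv h"] that by simp
  qed (use that in simp_all)
  have "?c ` G \<subseteq> (\<lambda>y. ?c (SOME g. g \<in> G \<and> F g = y)) ` F ` G"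
  proof
    fix C assume "C \<in> ?c ` G"
    then obtain g where g: "g \<in> G" "C = ?c g" by blast
    then have "\<exists>h. h \<in> G \<and> F h = F g" by blast
    then have "?c (SOME h. h \<in> G \<and> F h = F g) = ?c g"
      using eq g by (metis (mono_tags, lifting) someI_ex)
    then show "C \<in> (\<lambda>y. ?c (SOME g. g \<in> G \<and> F g = y)) ` F ` G"
      using g by blast
  qed
  moreover have "rcosets\<^bsub>aut_group G\<^esub> N = ?c ` G"
    by (auto simp: RCOSETS_def)
  ultimately show ?thesis
    using finite_subset[OF _ finite_imageI[OF assms(2)]] by simp
qed

lemma finite_exp: "finite (carrier E)"
proof -
  have "carrier E = (\<Pi>\<^sub>E j\<in>UNIV. {0..<int (ord_gen j)})"
    by (auto simp: PiE_UNIV_domain Pi_iff)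
  then show ?thesis by (simp add: finite_PiE)
qed

lemma finprod_eps_mult:
  fixes f g :: "'x \<Rightarrow> 'x list \<Rightarrow> 'x list"
  assumes "\<And>x. f x \<in> G" "\<And>x. g x \<in> G"
  shows "finprod E (\<lambda>x. eps' (f x \<star> g x)) UNIV =
    finprod E (\<lambda>x. eps' (f x)) UNIV \<otimes>\<^bsub>E\<^esub> finprod E (\<lambda>x. eps' (g x)) UNIV"
proof -
  have "(\<lambda>x. eps' (f x \<star> g x)) = (\<lambda>x. eps' (f x) \<otimes>\<^bsub>E\<^esub> eps' (g x))"
    using assms by (simp only: eps_mult)
  then show ?thesis
    using E.finprod_multf[of "\<lambda>x. eps' (f x)" UNIV "\<lambda>x. eps' (g x)"] assms eps_closed
    by (simp only: Pi_I)
qed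

lemma finprod_eps_closed:
  fixes f :: "'x \<Rightarrow> 'x list \<Rightarrow> 'x list"
  assumes "\<And>x. f x \<in> G" shows "finprod E (\<lambda>x. eps' (f x)) UNIV \<in> carrier E"
  using assms eps_closed by (intro E.finprod_closed) blast

lemma finprod_eps_single:
  fixes p :: 'x
  assumes "h \<in> G" shows "finprod E (\<lambda>x. eps' (if x = p then h else id)) UNIV = eps' h"
proof -
  have "(\<lambda>x. eps' (if x = p then h else id)) = (\<lambda>x. if x = p then eps' h else \<one>\<^bsub>E\<^esub>)"
    by (rule ext) (simp del: exp_group_simps)
  then show ?thesis
    using E.finprod_singleton_swap[of p "UNIV :: 'x set" "\<lambda>_. eps' h"] eps_closed[OF assms]
    by (simp del: exp_group_simps)
qed

text \<open>
A balanced tuple is the product of two tuples with one entry each, of opposite exponents.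
\<close>

lemma finprod_eps_balanced:
  assumes "h \<in> G" "p \<noteq> q" shows "finprod E (\<lambda>x. eps' (balanced p q h x)) UNIV = \<one>\<^bsub>E\<^esub>"
proof -
  have "balanced p q h x = (if x = p then h else id) \<star> (if x = q then tree_inv h else id)" for x
    using assms by (simp add: balanced_def)
  then have "finprod E (\<lambda>x. eps' (balanced p q h x)) UNIV =
      finprod E (\<lambda>x. eps' (if x = p then h else id)) UNIV \<otimes>\<^bsub>E\<^esub>
      finprod E (\<lambda>x. eps' (if x = q then tree_inv h else id)) UNIV"
    using assms(1) by (subst finprod_eps_mult[symmetric]) simp_all
  also have "\<dots> = eps' h \<otimes>\<^bsub>E\<^esub> inv\<^bsub>E\<^esub> (eps' h)"
    using assms(1) by (simp only: finprod_eps_single inv_in_hanoi eps_inv)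
  also have "\<dots> = \<one>\<^bsub>E\<^esub>" using eps_closed[OF assms(1)] by (rule E.r_inv)
  finally show ?thesis .
qed

lemma subgroup_B: "subgroup (B_group \<sigma>) tree_Aut"
proof (rule T.subgroupI)
  have "id \<in> B_group \<sigma>" using subgroup.one_closed[OF subgroup_root_derived] by (simp add: B_group_def)
  then show "B_group \<sigma> \<noteq> {}" by blast
next
  fix g assume "g \<in> B_group \<sigma>"
  then show "tree_inv g \<in> B_group \<sigma>"
    using subgroup.m_inv_closed[OF subgroup_root_derived] by (simp add: B_group_def root_perm_inv)
next
  fix g h assume "g \<in> B_group \<sigma>" "h \<in> B_group \<sigma>"
  then show "g \<star> h \<in> B_group \<sigma>"
    using subgroup.m_closed[OF subgroup_root_derived, of "root_perm g" "root_perm h"] by (simp add: B_group_def)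
qed (auto simp: B_group_def)

end

section \<open>Level stabilizers and rigid stabilizers when \<open>J\<close> lies in the group\<close>

locale hanoi_J = spinal \<sigma> for \<sigma> :: "'x::finite \<Rightarrow> 'x \<Rightarrow> 'x" +
  assumes transitive: "level_transitive G" and J_subset: "J_group \<sigma> \<subseteq> G"
begin

lemma balanced_in_hanoi:
  assumes "h \<in> G" "p \<noteq> q" shows "node (balanced p q h) id \<in> G"
proof -
  have "node (balanced p q h) id \<in> level_stab 1"
    using assms by (simp add: level_stab_1_iff del: One_nat_def)
  then have "node (balanced p q h) id \<in> J_gens \<sigma>"
    unfolding J_gens_def using assms by (auto simp: balanced_def)
  then show ?thesis
    using J_subset unfolding J_group_def by (meson generate.incl subsetD)
qed

text \<open>
By \<open>commutator_balanced\<close>, with two further letters \<open>q\<close> and \<open>r\<close>, it holds for commutators, and the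
elements with this property form a subgroup.
\<close>

lemma plant_single_derived:
  fixes p :: 'x
  assumes "d \<in> G'" shows "plant [p] d \<in> G'"
proof -
  obtain q where q: "q \<noteq> p" using exists_third_letter[of p p] by blast
  obtain r where r: "r \<noteq> p" "r \<noteq> q" by (rule exists_third_letter)
  have "G' \<subseteq> {d \<in> tree_auts. plant [p] d \<in> G'}"
  proof (rule derived_minimal[OF subgroup_plant[OF subgroup_derived]])
    fix g h assume gh: "g \<in> G" "h \<in> G"
    have "node (balanced p q g) id \<in> G" "node (balanced p r h) id \<in> G"
      using gh q r by (auto intro: balanced_in_hanoi)
    then have "plant [p] (g \<star> h \<star> tree_inv g \<star> tree_inv h) \<in> G'"
      using commutator_in_derived commutator_balanced[OF hanoi_closed hanoi_closed q r] gh by metis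
    then show "g \<star> h \<star> tree_inv g \<star> tree_inv h \<in> {d \<in> tree_auts. plant [p] d \<in> G'}"
      using gh by simp
  qed
  then show ?thesis using assms by blast
qed

lemma node_derived:
  fixes f :: "'x \<Rightarrow> 'x list \<Rightarrow> 'x list"
  assumes "\<And>x. f x \<in> G'" shows "node f id \<in> G'"
proof -
  have "graft 1 (\<lambda>v. f (hd v)) \<in> G'"
  proof (rule graft_in_subgroup[OF subgroup_derived])
    fix v :: "'x list" assume "length v = 1"
    then obtain x where "v = [x]" by (auto simp: length_Suc_conv)
    then show "plant v (f (hd v)) \<in> G'" using plant_single_derived[OF assms] by simp
  qed
  then show ?thesis by simp
qed

theorem hanoi_regular_branch: "regular_branch_over G G'"
  unfolding regular_branch_over_def
proof (intro conjI transitive)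
  show sub: "subgroup G' (aut_group G)" using derived_normal by (rule normal_imp_subgroup)
  have "eps' ` G \<subseteq> carrier E" using eps_closed by blast
  then have "finite (eps' ` G)" using finite_exp by (rule finite_subset)
  then show "finite (rcosets\<^bsub>aut_group G\<^esub> G')"
    using finite_rcosetsI[OF sub, of eps'] eps_eq_iff by blast
  show "{f. \<forall>x. f x \<in> G'} \<subseteq> psi ` (G' \<inter> level_stab 1)"
  proof
    fix f :: "'x \<Rightarrow> 'x list \<Rightarrow> 'x list" assume "f \<in> {f. \<forall>x. f x \<in> G'}"
    then have f: "\<And>x. f x \<in> G'" by blast
    then have "node f id \<in> G' \<inter> level_stab 1" by (simp add: node_derived level_stab_1_iff del: One_nat_def)
    then show "f \<in> psi ` (G' \<inter> level_stab 1)" by (metis image_eqI psi_node)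
  qed
qed

text \<open>
Multiplying by a balanced tuple moves the entry at \<open>x\<close> to the coordinate \<open>p\<close> without changing the total
exponent. Once all entries have been collected at \<open>p\<close>, the remaining entry has exponent zero, so it lies
in \<open>G'\<close>.
\<close>

lemma node_in_hanoi_if_eps_one:
  fixes f :: "'x \<Rightarrow> 'x list \<Rightarrow> 'x list"
  assumes "\<And>x. f x \<in> G" "finprod E (\<lambda>x. eps' (f x)) UNIV = \<one>\<^bsub>E\<^esub>"
  shows "node f id \<in> G"
proof -
  obtain p :: 'x where True by blast
  have "node f id \<in> G" if "finite S" "p \<notin> S" "\<And>x. f x \<in> G" "\<And>x. x \<notin> insert p S \<Longrightarrow> f x = id"
      "finprod E (\<lambda>x. eps' (f x)) UNIV = \<one>\<^bsub>E\<^esub>" for S and f :: "'x \<Rightarrow> 'x list \<Rightarrow> 'x list"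
    using that
  proof (induction S arbitrary: f)
    case empty
    have out: "f x = id" if "x \<noteq> p" for x by (rule empty(3)) (use that in simp)
    have f: "f = (\<lambda>x. if x = p then f p else id)" by (rule ext) (simp add: out)
    have "eps' (f p) = \<one>\<^bsub>E\<^esub>"
      using empty(4) finprod_eps_single[OF empty(2)[of p], of p] by (subst (asm) f) (simp del: exp_group_simps)
    then have "f p \<in> G'" using eps_eq_one_iff empty(2) by blast
    then have "plant [p] (f p) \<in> G'" by (rule plant_single_derived)
    then have "node (\<lambda>x. if x = p then f p else id) id \<in> G'" by (simp only: plant_single)
    then show "node f id \<in> G" using f by simp
  next
    case (insert x S)
    let ?b = "balanced p x (f x)"
    have b: "node ?b id \<in> G" using insert by (intro balanced_in_hanoi) auto
    have "node (\<lambda>y. f y \<star> ?b y) id \<in> G"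
    proof (rule insert.IH)
      show "p \<notin> S" using insert by blast
      show bG: "f y \<star> ?b y \<in> G" for y
        using insert.prems(2) by (simp add: balanced_def)
      show "f y \<star> ?b y = id" if "y \<notin> insert p S" for y
        using that insert.prems(2,3) by (cases "y = x") (auto simp: balanced_def)
      have "finprod E (\<lambda>y. eps' (f y \<star> ?b y)) UNIV =
          finprod E (\<lambda>y. eps' (f y)) UNIV \<otimes>\<^bsub>E\<^esub> finprod E (\<lambda>y. eps' (?b y)) UNIV"
        using insert.prems(2) by (intro finprod_eps_mult) (simp_all add: balanced_def)
      also have "\<dots> = \<one>\<^bsub>E\<^esub>"
        using insert.prems finprod_eps_balanced[of "f x" p x] E.l_one[OF E.one_closed]
        by (simp only: insert_iff) auto
      finally show "finprod E (\<lambda>y. eps' (f y \<star> ?b y)) UNIV = \<one>\<^bsub>E\<^esub>" .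
    qed
    then have "node f id \<star> node ?b id \<in> G"
      by (simp add: node_mult)
    then have "(node f id \<star> node ?b id) \<star> tree_inv (node ?b id) \<in> G"
      using b by (rule mult_in_hanoi[OF _ inv_in_hanoi])
    then show "node f id \<in> G"
      by (simp only: tree_mult_assoc tree_inv_mult hanoi_closed[OF b] id_tree_mult)
  qed
  from this[of "UNIV - {p}" f] show ?thesis using assms by auto
qed

text \<open>
If \<open>\<lambda>\<close> kills the total exponent of the tuple, this exponent belongs to some element of \<open>G\<close> whose root
permutation is that of an element of \<open>G'\<close>. Dividing by the latter gives an element \<open>u\<close> of \<open>G\<close> in the
level stabilizer with the same exponent, and the tuple differs from the sections of \<open>u\<close> by a tuple of
total exponent zero.
\<close>

lemma node_in_hanoi_iff:
  fixes f :: "'x \<Rightarrow> 'x list \<Rightarrow> 'x list"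
  assumes "\<And>x. f x \<in> tree_auts"
  shows "node f id \<in> G \<longleftrightarrow> (\<forall>x. f x \<in> G) \<and>
    finprod E (\<lambda>x. eps' (f x)) UNIV \<in> kernel E (root_ab \<sigma>) (lam \<sigma>)"
proof (intro iffI conjI allI)
  assume n: "node f id \<in> G"
  show "f x \<in> G" for x using psi_in_hanoi[OF n, of x] by simp
  have "node f id \<in> B_group \<sigma>"
    using n subgroup.one_closed[OF subgroup_root_derived] by (simp add: B_group_def)
  then show "finprod E (\<lambda>x. eps' (f x)) UNIV \<in> kernel E (root_ab \<sigma>) (lam \<sigma>)"
    using eps_in_kernel_iff[OF n] finprod_eps_psi[OF n] by simp
next
  let ?c = "finprod E (\<lambda>x. eps' (f x)) UNIV"
  assume "(\<forall>x. f x \<in> G) \<and> ?c \<in> kernel E (root_ab \<sigma>) (lam \<sigma>)"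
  then have f: "\<And>x. f x \<in> G" and ker: "?c \<in> kernel E (root_ab \<sigma>) (lam \<sigma>)" by blast+
  have c: "?c \<in> carrier E" using f by (rule finprod_eps_closed)
  then obtain g where g: "g \<in> G" "eps' g = ?c" by (rule eps_surj)
  then have "g \<in> B_group \<sigma>" using ker eps_in_kernel_iff by metis
  then have "root_perm g \<in> root_perm ` G'" by (simp add: B_group_def root_derived_eq)
  then obtain k where k: "k \<in> G'" "root_perm g = root_perm k" by blast
  define u where "u = g \<star> tree_inv k"
  have u: "u \<in> G" using g k by (simp add: u_def)
  have root: "root_perm u = id"
  proof -
    have "root_perm u = root_perm (tree_inv k) \<circ> root_perm k"
      using g k by (simp only: u_def root_perm_mult hanoi_closed derived_closed tree_inv_closed)
    also have "\<dots> = root_perm (k \<star> tree_inv k)"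
      using k by (simp only: root_perm_mult hanoi_closed derived_closed tree_inv_closed)
    also have "\<dots> = id"
      using k by (simp only: tree_inv_mult hanoi_closed derived_closed root_perm_id)
    finally show ?thesis .
  qed
  \<comment> \<open>\<open>u\<close> and \<open>g\<close> differ by an element of \<open>G'\<close>, so they have the same exponent.\<close>
  have "u \<star> tree_inv g = g \<star> tree_inv k \<star> tree_inv g \<star> tree_inv (tree_inv k) \<star> tree_inv k"
    using g k by (simp add: u_def tree_mult_assoc)
  also have "\<dots> \<in> G'"
    using commutator_in_derived[of g "tree_inv k"] g k subgroup.m_closed[OF subgroup_derived]
      subgroup.m_inv_closed[OF subgroup_derived] by simp
  finally have eps_u: "eps' u = ?c" using eps_eq_iff u g by metis
  define f' where "f' x = f x \<star> tree_inv (psi u x)" for x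
  have f': "f' x \<in> G" for x using f u by (simp add: f'_def)
  have f_eq: "f x = f' x \<star> psi u x" for x using u by (simp add: f'_def tree_mult_assoc)
  have "?c = finprod E (\<lambda>x. eps' (f' x)) UNIV \<otimes>\<^bsub>E\<^esub> finprod E (\<lambda>x. eps' (psi u x)) UNIV"
    unfolding f_eq using f' u by (intro finprod_eps_mult) simp_all
  also have "\<dots> = finprod E (\<lambda>x. eps' (f' x)) UNIV \<otimes>\<^bsub>E\<^esub> ?c"
    using finprod_eps_psi[OF u] eps_u by simp
  finally have "finprod E (\<lambda>x. eps' (f' x)) UNIV = \<one>\<^bsub>E\<^esub>"
    by (simp only: E.r_cancel_one'[OF c finprod_eps_closed[OF f']])
  then have "node f' id \<in> G" using f' by (intro node_in_hanoi_if_eps_one)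
  then have "node f' id \<star> u \<in> G" using u by simp
  moreover have "node f' id \<star> u = node f id"
  proof -
    have "u = node (psi u) id" using node_psi[of u] root u by simp
    then have "node f' id \<star> u = node f' id \<star> node (psi u) id" by simp
    then show ?thesis by (simp add: node_mult flip: f_eq)
  qed
  ultimately show "node f id \<in> G" by simp
qed

theorem psi_level_stab_hanoi:
  "psi ` (G \<inter> level_stab 1) = {f. (\<forall>x. f x \<in> G) \<and>
    finprod E (\<lambda>x. eps' (f x)) UNIV \<in> kernel E (root_ab \<sigma>) (lam \<sigma>)}"
proof (intro subset_antisym subsetI)
  fix f assume "f \<in> psi ` (G \<inter> level_stab 1)"
  then obtain g where g: "g \<in> G" "root_perm g = id" "f = psi g" by (auto simp: level_stab_1_iff simp del: One_nat_def)
  then have "node f id = g" using node_psi[of g] by simp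
  then show "f \<in> {f. (\<forall>x. f x \<in> G) \<and> finprod E (\<lambda>x. eps' (f x)) UNIV \<in> kernel E (root_ab \<sigma>) (lam \<sigma>)}"
    using g node_in_hanoi_iff[of f] by simp
next
  fix f :: "'x \<Rightarrow> 'x list \<Rightarrow> 'x list" assume f: "f \<in> {f. (\<forall>x. f x \<in> G) \<and> finprod E (\<lambda>x. eps' (f x)) UNIV \<in> kernel E (root_ab \<sigma>) (lam \<sigma>)}"
  then have "node f id \<in> G" using node_in_hanoi_iff[of f] by simp
  then have "node f id \<in> G \<inter> level_stab 1" by (simp add: level_stab_1_iff del: One_nat_def)
  then show "f \<in> psi ` (G \<inter> level_stab 1)" by (metis image_eqI psi_node)
qed

text \<open>
A generator of \<open>J\<close> has a prescribed element of \<open>G\<close> in a prescribed coordinate.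
\<close>

theorem hanoi_strongly_fractal: "strongly_fractal G"
  unfolding strongly_fractal_def
proof (intro conjI allI hanoi_self_similar subset_antisym subsetI)
  fix x :: 'x and g assume "g \<in> G"
  obtain q where q: "q \<noteq> x" using exists_third_letter[of x x] by blast
  let ?n = "node (balanced x q g) id"
  have "?n \<in> G \<inter> level_stab 1" "tree_section ?n [x] = g"
    using balanced_in_hanoi[OF \<open>g \<in> G\<close>, of x q] q fun_cong[OF psi_node[of "balanced x q g" id], of x]
    by (simp_all add: level_stab_1_iff psi_def del: One_nat_def) (simp add: balanced_def)
  then show "g \<in> (\<lambda>g. tree_section g [x]) ` (G \<inter> level_stab 1)" by (metis image_eqI)
qed auto

lemma plant_single_in_hanoi_iff:
  fixes x :: 'x
  assumes "g \<in> tree_auts" shows "plant [x] g \<in> G \<longleftrightarrow> g \<in> B_group \<sigma>"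
proof -
  have "plant [x] g \<in> G \<longleftrightarrow> (\<forall>y. (if y = x then g else id) \<in> G) \<and>
      finprod E (\<lambda>y. eps' (if y = x then g else id)) UNIV \<in> kernel E (root_ab \<sigma>) (lam \<sigma>)"
    unfolding plant_single using assms by (intro node_in_hanoi_iff) simp
  also have "(\<forall>y. (if y = x then g else id) \<in> G) \<longleftrightarrow> g \<in> G" by auto
  finally show ?thesis
    using finprod_eps_single[of g x] eps_in_kernel_iff[of g] by (auto simp: B_group_def)
qed

text \<open>
One level is \<open>plant_single_in_hanoi_iff\<close>. Further down, the section of \<open>plant (x # v) g\<close> at \<open>x\<close> has
trivial root permutation, so for it lying in \<open>B\<close> and lying in \<open>G\<close> are the same.
\<close>

lemma plant_in_hanoi_iff:
  fixes v :: "'x list"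
  assumes "g \<in> tree_auts" "v \<noteq> []" shows "plant v g \<in> G \<longleftrightarrow> g \<in> B_group \<sigma>"
  using assms(2)
proof (induction v)
  case (Cons x v)
  show "plant (x # v) g \<in> G \<longleftrightarrow> g \<in> B_group \<sigma>"
  proof (cases v)
    case Nil
    then show ?thesis using plant_single_in_hanoi_iff[OF assms(1), of x] by simp
  next
    case v: (Cons y v')
    have "plant (x # v) g \<in> G \<longleftrightarrow> plant [x] (plant v g) \<in> G"
      using plant_plant[of "[x]" v g] by (simp only: append_Cons append_Nil)
    also have "\<dots> \<longleftrightarrow> plant v g \<in> B_group \<sigma>"
      using assms(1) by (intro plant_single_in_hanoi_iff) simp
    also have "\<dots> \<longleftrightarrow> plant v g \<in> G"
      using subgroup.one_closed[OF subgroup_root_derived] by (simp add: B_group_def v)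
    finally show ?thesis using Cons.IH v by simp
  qed
qed simp

text \<open>
An element of the rigid stabilizer fixes \<open>v\<close> too: were \<open>g v\<close> another word of the same length, it would be
fixed by \<open>g\<close>, against injectivity. So the element is determined by its section at \<open>v\<close>.
\<close>

lemma rist_eq:
  fixes v :: "'x list"
  assumes "v \<noteq> []" shows "rist G v = plant v ` B_group \<sigma>"
proof (intro subset_antisym subsetI)
  fix g assume "g \<in> rist G v"
  then have g: "g \<in> G" and outside: "\<And>w. \<not> prefix v w \<Longrightarrow> g w = w" by (auto simp: rist_def)
  have eq: "prefix v (u @ w) \<longleftrightarrow> u = v" if "length u = length v" for u w
    using that by (auto simp: prefix_def)
  have "g u = u" if "length u = length v" for u
  proof (cases "u = v \<and> g v \<noteq> v")
    case True
    then have "g (g v) = g v" using outside[of "g v"] eq[of "g v" "[]"] g by simp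
    then show ?thesis using True g tree_aut_inj hanoi_closed by metis
  next
    case False
    then show ?thesis using outside[of u] eq[OF that, of "[]"] by auto
  qed
  then have "g \<in> level_stab (length v)" using g by (simp add: level_stab_def level_def)
  then have "g = graft (length v) (tree_section g)" by (rule graft_section[symmetric])
  also have "\<dots> = plant v (tree_section g v)"
  proof (rule graft_cong)
    fix u :: "'x list" assume u: "length u = length v"
    show "tree_section g u = (if u = v then tree_section g v else id)"
      using outside eq[OF u] u by (auto simp: tree_section_def fun_eq_iff)
  qed
  finally have plant: "g = plant v (tree_section g v)" .
  then have "tree_section g v \<in> B_group \<sigma>"
    using plant_in_hanoi_iff[OF _ assms, of "tree_section g v"] g by simp
  then show "g \<in> plant v ` B_group \<sigma>" using plant by blast
next
  fix g assume "g \<in> plant v ` B_group \<sigma>"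
  then obtain b where b: "b \<in> B_group \<sigma>" "g = plant v b" by blast
  then have "b \<in> tree_auts" using subgroup.subset[OF subgroup_B] by auto
  then have "g \<in> G" using plant_in_hanoi_iff assms b by blast
  moreover have "g w = w" if "\<not> prefix v w" for w
    unfolding b(2) using that by (rule plant_outside)
  ultimately show "g \<in> rist G v" by (simp add: rist_def)
qed

text \<open>
The tuples over \<open>B\<close> form a subgroup containing the rigid stabilizers of the level, and each of them is the
product of its entries.
\<close>

lemma Rist_eq:
  assumes "m \<ge> 1" shows "Rist G m = graft m ` {f. \<forall>v. length v = m \<longrightarrow> f v \<in> B_group \<sigma>}" (is "_ = ?R")
proof (rule subset_antisym)
  have B: "b \<in> tree_auts" if "b \<in> B_group \<sigma>" for b using that by (simp add: B_group_def)
  have ne: "v \<noteq> []" if "length v = m" for v :: "'x list" using that assms by auto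
  have R: "subgroup ?R tree_Aut"
  proof (rule T.subgroupI)
    show "?R \<subseteq> carrier tree_Aut" using B by auto
    show "?R \<noteq> {}" using subgroup.one_closed[OF subgroup_B] by auto
  next
    fix g assume "g \<in> ?R"
    then obtain f where f: "\<And>v. length v = m \<Longrightarrow> f v \<in> B_group \<sigma>" "g = graft m f" by blast
    then have "tree_inv g = graft m (\<lambda>v. tree_inv (f v))" using B by (simp add: graft_inv)
    then show "tree_inv g \<in> ?R" using f subgroup.m_inv_closed[OF subgroup_B] by blast
  next
    fix g h assume "g \<in> ?R" "h \<in> ?R"
    then obtain e f where f: "\<And>v. length v = m \<Longrightarrow> e v \<in> B_group \<sigma>" "g = graft m e"
      "\<And>v. length v = m \<Longrightarrow> f v \<in> B_group \<sigma>" "h = graft m f" by blast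
    then have "g \<star> h = graft m (\<lambda>v. e v \<star> f v)" by (simp add: graft_mult)
    then show "g \<star> h \<in> ?R" using f subgroup.m_closed[OF subgroup_B] by blast
  qed
  have "rist G v \<subseteq> ?R" if v: "v \<in> level m" for v
  proof
    fix g assume "g \<in> rist G v"
    then obtain b where b: "b \<in> B_group \<sigma>" "g = plant v b"
      using rist_eq[OF ne] v by (auto simp: level_def)
    then have "g = graft m (\<lambda>u. if u = v then b else id)" using v by (simp add: level_def)
    then show "g \<in> ?R" using b subgroup.one_closed[OF subgroup_B] by auto
  qed
  then show "Rist G m \<subseteq> ?R"
    unfolding Rist_def by (intro T.generate_subgroup_incl[OF _ R]) blast
  have sub: "subgroup (Rist G m) tree_Aut"
    unfolding Rist_def by (rule T.generate_is_subgroup) (auto simp: rist_def)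
  show "?R \<subseteq> Rist G m"
  proof (rule image_subsetI)
    fix f :: "'x list \<Rightarrow> 'x list \<Rightarrow> 'x list"
    assume f: "f \<in> {f. \<forall>v. length v = m \<longrightarrow> f v \<in> B_group \<sigma>}"
    show "graft m f \<in> Rist G m"
    proof (rule graft_in_subgroup[OF sub])
      fix v :: "'x list" assume v: "length v = m"
      have "plant v (f v) \<in> rist G v" using f v rist_eq[OF ne[OF v]] by blast
      then show "plant v (f v) \<in> Rist G m"
        unfolding Rist_def using v by (intro generate.incl) (auto simp: level_def)
    qed
  qed
qed

theorem psi_level_Rist:
  assumes "m \<ge> 1" shows "psi_level m ` Rist G m = (\<Pi>\<^sub>E v\<in>level m. B_group \<sigma>)"
proof -
  have psi: "psi_level m (graft m f) = restrict f (level m)" for f :: "'x list \<Rightarrow> 'x list \<Rightarrow> 'x list"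
    by (auto simp: psi_level_def level_def restrict_def)
  show ?thesis
  proof (intro subset_antisym subsetI)
    fix f :: "'x list \<Rightarrow> 'x list \<Rightarrow> 'x list" assume "f \<in> (\<Pi>\<^sub>E v\<in>level m. B_group \<sigma>)"
    then have "f = psi_level m (graft m f)" "graft m f \<in> Rist G m"
      using psi[of f] Rist_eq[OF assms] by (auto simp: level_def PiE_restrict PiE_iff)
    then show "f \<in> psi_level m ` Rist G m" by blast
  next
    fix f assume "f \<in> psi_level m ` Rist G m"
    then obtain e where "\<forall>v. length v = m \<longrightarrow> e v \<in> B_group \<sigma>" "f = restrict e (level m)"
      using psi by (auto simp: Rist_eq[OF assms])
    then show "f \<in> (\<Pi>\<^sub>E v\<in>level m. B_group \<sigma>)" by (simp add: level_def)
  qed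
qed

section \<open>Just infiniteness\<close>

text \<open>
Conjugating the balanced tuple on \<open>i\<close> and \<open>\<sigma> i r\<close> by \<open>a i\<close> moves its second entry from \<open>\<sigma> i r\<close> to \<open>r\<close>.
So the commutator with \<open>a i\<close> is the balanced tuple on \<open>r\<close> and \<open>\<sigma> i r\<close> times a commutator planted at
the fixed letter \<open>i\<close>, and the latter is already known to lie in \<open>G'\<close>.
\<close>

lemma balanced_step_in_derived:
  assumes "h \<in> G" "\<sigma> i r \<noteq> r"
  shows "node (balanced r (\<sigma> i r) h) id \<in> G'"
proof -
  have ri: "r \<noteq> i" and si: "\<sigma> i r \<noteq> i" using assms(2) by auto
  define j where "j = node (balanced i (\<sigma> i r) h) id"
  define k where "k = node (balanced r (\<sigma> i r) h) id"
  define c where "c = plant [i] (h \<star> a i \<star> tree_inv h \<star> tree_inv (a i))"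
  have j: "j \<in> G" unfolding j_def using assms(1) si by (intro balanced_in_hanoi) auto
  have k: "k \<in> G" unfolding k_def using assms by (intro balanced_in_hanoi) auto
  have c: "c \<in> G'"
    unfolding c_def using assms(1) by (intro plant_single_derived commutator_in_derived) simp_all
  have h: "h \<in> tree_auts" using assms(1) by simp
  have "c \<star> k \<star> (a i \<star> j) = j \<star> a i"
  proof (rule tree_aut_eqI)
    show "c \<star> k \<star> (a i \<star> j) \<in> tree_auts" "j \<star> a i \<in> tree_auts"
      using j k c by (intro tree_mult_closed; simp)+
    have pc: "root_perm c = id" "root_perm k = id" "root_perm j = id"
      by (simp_all add: c_def k_def j_def)
    then show "root_perm (c \<star> k \<star> (a i \<star> j)) = root_perm (j \<star> a i)"
      using j k c by simp
    fix x
    have "psi (c \<star> k \<star> (a i \<star> j)) x = psi c x \<star> psi k x \<star> (psi (a i) x \<star> psi j (\<sigma> i x))"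
      using j k c by (simp add: psi_mult pc del: psi_gen)
    also have "\<dots> = psi j x \<star> psi (a i) x"
      unfolding c_def k_def j_def plant_single psi_node
      using h ri si assms(2) sigma_eq_iff[of i x r] sigma_eq_iff[of i "\<sigma> i r" r]
      by (auto simp: balanced_def tree_mult_assoc)
    finally show "psi (c \<star> k \<star> (a i \<star> j)) x = psi (j \<star> a i) x"
      using j by (simp add: psi_mult pc)
  qed
  then have "c \<star> k \<star> (a i \<star> j) \<star> tree_inv j \<star> tree_inv (a i) = j \<star> a i \<star> tree_inv j \<star> tree_inv (a i)"
    by simp
  then have "c \<star> k = j \<star> a i \<star> tree_inv j \<star> tree_inv (a i)"
    using j by (simp add: tree_mult_assoc)
  then have "c \<star> k \<in> G'" using commutator_in_derived[OF j gen_in_hanoi] by simp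
  then have "tree_inv c \<star> (c \<star> k) \<in> G'"
    using c subgroup.m_closed[OF subgroup_derived] subgroup.m_inv_closed[OF subgroup_derived] by blast
  then show ?thesis using c by (simp add: k_def)
qed

text \<open>
Being joined by balanced tuples from \<open>G'\<close> is a transitive relation on letters. It holds between \<open>r\<close> and
\<open>\<sigma> i r\<close>, and the root group is transitive. Equal letters have to be admitted, since a permutation may fix
the letter.
\<close>

lemma balanced_in_derived:
  assumes "h \<in> G" "p \<noteq> q" shows "node (balanced p q h) id \<in> G'"
proof -
  define linked where "linked p q \<longleftrightarrow> p = q \<or> (\<forall>h\<in>G. node (balanced p q h) id \<in> G')" for p q
  have step: "linked r (\<sigma> i r)" for i r
    using balanced_step_in_derived[of _ i r] by (cases "\<sigma> i r = r") (auto simp: linked_def)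
  have trans: "linked p r" if "linked p q" "linked q r" for p q r
  proof (cases "p = q \<or> q = r \<or> p = r")
    case True then show ?thesis using that by (auto simp: linked_def)
  next
    case False
    have "node (balanced p r h) id \<in> G'" if h: "h \<in> G" for h
    proof -
      have "node (balanced p q h) id \<in> G'" "node (balanced q r h) id \<in> G'"
        using \<open>linked p q\<close> \<open>linked q r\<close> False h by (auto simp: linked_def)
      then have "node (balanced p q h) id \<star> node (balanced q r h) id \<in> G'"
        by (rule subgroup.m_closed[OF subgroup_derived])
      moreover have "(\<lambda>x. balanced p q h x \<star> balanced q r h x) = balanced p r h"
        using False h by (auto simp: balanced_def fun_eq_iff)
      ultimately show ?thesis by (simp add: node_mult)
    qed
    then show ?thesis by (simp add: linked_def)
  qed
  have "linked p (root_perm (word_aut w) p)" for p w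
  proof (induction w arbitrary: p)
    case Nil show "linked p (root_perm (word_aut []) p)" by (simp add: linked_def)
  next
    case (Cons i w)
    have "linked (\<sigma> i p) (root_perm (word_aut w) (\<sigma> i p))" by (rule Cons)
    then show "linked p (root_perm (word_aut (i # w)) p)" using step[of p i] trans by simp
  qed
  moreover obtain w where "root_perm (word_aut w) p = q"
  proof -
    have "[p] \<in> level 1" "[q] \<in> level 1" by (simp_all add: level_def)
    then obtain g where "g \<in> G" "g [p] = [q]" using transitive unfolding level_transitive_def by blast
    then show ?thesis using that by (metis hanoi_word list.sel(1) root_perm_def)
  qed
  ultimately have "linked p q" by metis
  then show ?thesis using assms by (simp add: linked_def)
qed

lemma plant_derived:
  assumes "d \<in> G'" shows "plant v d \<in> G'"
proof (induction v)
  case Nil show "plant [] d \<in> G'" using assms by simp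
next
  case (Cons x v)
  have "plant v d \<in> G'" by (rule Cons)
  then have "plant [x] (plant v d) \<in> G'" by (rule plant_single_derived)
  then show "plant (x # v) d \<in> G'" by (simp only: plant_plant append_Cons append_Nil)
qed

text \<open>
Let \<open>A\<close> and \<open>B\<close> be \<open>x\<close> and \<open>y\<close> planted at \<open>u\<close>. The commutator \<open>D\<close> of \<open>A\<close> and \<open>g\<close> lies in \<open>N\<close>. It is the
product of \<open>A\<close> with a conjugate \<open>C\<close> of its inverse, and \<open>C\<close> acts trivially below \<open>u\<close>, since \<open>g\<close> moves
\<open>u\<close>. Hence \<open>C\<close> commutes with \<open>B\<close>, and the commutator of \<open>D\<close> and \<open>B\<close> is that of \<open>A\<close> and \<open>B\<close>.
\<close>

lemma normal_plant_commutator: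
  assumes N: "N \<lhd> aut_group G" and g: "g \<in> N" "g u \<noteq> u" and xy: "x \<in> G'" "y \<in> G'"
  shows "plant u (x \<star> y \<star> tree_inv x \<star> tree_inv y) \<in> N"
proof -
  interpret N: normal N "aut_group G" by (rule N)
  define A where "A = plant u x"
  define B where "B = plant u y"
  define C where "C = g \<star> tree_inv A \<star> tree_inv g"
  have gG: "g \<in> G" using g N.subset by auto
  have A: "A \<in> G" and B: "B \<in> G"
    using xy plant_derived derived_closed unfolding A_def B_def by blast+
  have C: "C \<in> G" using A gG by (simp add: C_def)
  note aut = hanoi_closed[OF gG] hanoi_closed[OF A] hanoi_closed[OF B] hanoi_closed[OF C]
  have C_inside: "C w = w" if "prefix u w" for w
  proof -
    have "\<not> prefix u (g w)"
    proof
      assume "prefix u (g w)"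
      moreover have "prefix (g u) (g w)" using that aut by simp
      ultimately have "u = g u"
        using aut by (metis length_tree_aut prefix_length_prefix prefix_order.antisym order_refl)
      then show False using g by simp
    qed
    then have "A (g w) = g w" unfolding A_def by (rule plant_outside)
    then have "tree_inv A (g w) = g w" using aut by (metis tree_inv_apply(2))
    then show ?thesis using aut by (simp add: C_def)
  qed
  have "C \<star> B = B \<star> C"
  proof
    fix w
    show "(C \<star> B) w = (B \<star> C) w"
    proof (cases "prefix u w")
      case True
      then obtain z where "w = u @ z" by (rule prefixE)
      then have "prefix u (B w)" by (simp add: B_def)
      then show ?thesis using True C_inside by simp
    next
      case False
      have "\<not> prefix u (C w)"
        using False C_inside[of "C w"] tree_aut_inj[OF aut(4), of "C w" w] by metis
      then have "B (C w) = C w" unfolding B_def by (rule plant_outside)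
      moreover have "B w = w" unfolding B_def using False by (rule plant_outside)
      ultimately show ?thesis by simp
    qed
  qed
  then have comm: "C \<star> B \<star> tree_inv C = B"
    using aut by (simp add: tree_mult_assoc)
  define D where "D = A \<star> C"
  have D: "D \<in> N"
  proof -
    have "A \<star> g \<star> tree_inv A \<in> N"
      using N.inv_op_closed2[of A g] A g by simp
    then have "A \<star> g \<star> tree_inv A \<star> tree_inv g \<in> N"
      using N.m_closed[of "A \<star> g \<star> tree_inv A" "tree_inv g"] N.m_inv_closed[OF g(1)] gG by simp
    then show ?thesis by (simp add: D_def C_def tree_mult_assoc)
  qed
  have "B \<star> tree_inv D \<star> tree_inv B \<in> N"
    using N.inv_op_closed2[of B "tree_inv D"] B N.m_inv_closed[OF D] A C by (simp add: D_def)
  then have "D \<star> (B \<star> tree_inv D \<star> tree_inv B) \<in> N"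
    using N.m_closed[OF D] by simp
  also have "D \<star> (B \<star> tree_inv D \<star> tree_inv B) = A \<star> (C \<star> B \<star> tree_inv C) \<star> tree_inv A \<star> tree_inv B"
    using aut T.inv_mult_group[of A C] by (simp add: D_def tree_mult_assoc)
  also have "\<dots> = A \<star> B \<star> tree_inv A \<star> tree_inv B"
    by (simp only: comm)
  also have "\<dots> = plant u (x \<star> y \<star> tree_inv x \<star> tree_inv y)"
    using xy by (simp only: A_def B_def plant_mult plant_inv derived_closed hanoi_closed)
  finally show ?thesis .
qed

text \<open>
By transitivity every vertex of the level of a moved vertex is moved by some element of \<open>N\<close>. One level
further down, a planted commutator is a commutator of elements of \<open>J\<close>, which lie in \<open>G'\<close>, so
\<open>normal_plant_commutator\<close> applies.
\<close>

lemma normal_contains_level_derived: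
  assumes N: "N \<lhd> aut_group G" "N \<noteq> {id}"
  obtains n where "\<And>f. (\<And>v. length v = n \<Longrightarrow> f v \<in> G') \<Longrightarrow> graft n f \<in> N"
proof -
  interpret N: normal N "aut_group G" by (rule N)
  have N_tree: "subgroup N tree_Aut"
    using T.incl_subgroup[OF subgroup_hanoi N.subgroup_axioms] .
  obtain g v where g: "g \<in> N" "g v \<noteq> v"
  proof -
    obtain g where "g \<in> N" "g \<noteq> id" using N(2) N.one_closed by auto
    then show ?thesis using that by (metis eq_id_iff)
  qed
  have gG: "g \<in> G" using g N.subset by auto
  have moved: "\<exists>g'\<in>N. g' u \<noteq> u" if u: "length u = length v" for u
  proof -
    obtain c where c: "c \<in> G" "c v = u"
      using transitive u unfolding level_transitive_def level_def by blast
    have "tree_inv c \<star> g \<star> c \<in> N" using N.inv_op_closed1[of c g] c g by simp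
    moreover have "tree_inv c u = v" using c tree_inv_apply(2) hanoi_closed by metis
    then have "(tree_inv c \<star> g \<star> c) u \<noteq> u"
      using c g tree_aut_inj[of c "g v" v] by simp
    ultimately show ?thesis by blast
  qed
  have plant: "plant w d \<in> N" if w: "length w = Suc (length v)" and d: "d \<in> G'" for w d
  proof -
    obtain u p where up: "w = u @ [p]" "length u = length v" using w by (metis length_append_singleton length_Suc_conv_rev nat.inject)
    then obtain g' where g': "g' \<in> N" "g' u \<noteq> u" using moved by blast
    obtain q where q: "q \<noteq> p" using exists_third_letter[of p p] by blast
    obtain r where r: "r \<noteq> p" "r \<noteq> q" by (rule exists_third_letter)
    have "G' \<subseteq> {d \<in> tree_auts. plant w d \<in> N}"
    proof (rule derived_minimal[OF subgroup_plant[OF N_tree]])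
      fix h k assume hk: "h \<in> G" "k \<in> G"
      have "node (balanced p q h) id \<in> G'" "node (balanced p r k) id \<in> G'"
        using hk q r by (auto intro: balanced_in_derived)
      then have "plant u (plant [p] (h \<star> k \<star> tree_inv h \<star> tree_inv k)) \<in> N"
        using normal_plant_commutator[OF N(1) g']
          commutator_balanced[OF hanoi_closed hanoi_closed q r] hk by metis
      then have "plant w (h \<star> k \<star> tree_inv h \<star> tree_inv k) \<in> N"
        by (simp only: plant_plant up(1))
      then show "h \<star> k \<star> tree_inv h \<star> tree_inv k \<in> {d \<in> tree_auts. plant w d \<in> N}"
        using hk by simp
    qed
    then show ?thesis using d by blast
  qed
  have "graft (Suc (length v)) f \<in> N" if "\<And>u. length u = Suc (length v) \<Longrightarrow> f u \<in> G'" for f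
    by (rule graft_in_subgroup[OF N_tree], rule plant, assumption, rule that, assumption)
  then show ?thesis by (rule that)
qed

text \<open>
A transitive finite group would bound the sizes of all levels.
\<close>

lemma infinite_hanoi: "infinite G"
proof
  assume fin: "finite G"
  have "card (UNIV :: 'x set) \<noteq> 1"
    using exists_third_letter by (metis UNIV_I card_1_singletonE singletonD)
  then have card: "card (UNIV :: 'x set) > 1"
    using finite_UNIV_card_ge_0[where 'a = 'x] by simp
  define n where "n = card G"
  have "level n \<subseteq> (\<lambda>g. g (replicate n undefined)) ` G"
  proof
    fix v :: "'x list" assume "v \<in> level n"
    moreover have "replicate n undefined \<in> level n" by (simp add: level_def)
    ultimately obtain g where "g \<in> G" "g (replicate n undefined) = v"
      using transitive unfolding level_transitive_def by blast
    then show "v \<in> (\<lambda>g. g (replicate n undefined)) ` G" by blast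
  qed
  then have "card (level n :: 'x list set) \<le> n"
    unfolding n_def by (rule surj_card_le[OF fin])
  moreover have "card (level n :: 'x list set) = card (UNIV :: 'x set) ^ n"
    using card_lists_length_eq[of "UNIV :: 'x set" n] by (simp add: level_def)
  moreover have "n < card (UNIV :: 'x set) ^ n"
    using card by (intro power_gt_expt) simp
  ultimately show False by simp
qed

text \<open>
Two elements lie in the same coset of \<open>N\<close> if they agree on the level given by
\<open>normal_contains_level_derived\<close> and their sections there have the same exponents; these data take
finitely many values.
\<close>

theorem hanoi_just_infinite: "just_infinite (aut_group G)"
  unfolding just_infinite_def
proof (intro conjI allI impI)
  show "infinite (carrier (aut_group G))" using infinite_hanoi by simp
  fix N assume "N \<lhd> aut_group G \<and> N \<noteq> {\<one>\<^bsub>aut_group G\<^esub>}"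
  then have N: "N \<lhd> aut_group G" "N \<noteq> {id}" by simp_all
  obtain n where n: "\<And>f. (\<And>v. length v = n \<Longrightarrow> f v \<in> G') \<Longrightarrow> graft n f \<in> N"
    using normal_contains_level_derived[OF N] by blast
  define F where "F g = (restrict g (level n), restrict (\<lambda>v. eps' (tree_section g v)) (level n))" for g
  have fin_level: "finite (level n :: 'x list set)"
    using finite_lists_length_eq[of "UNIV :: 'x set" n] by (simp add: level_def)
  have "F ` G \<subseteq> (level n \<rightarrow>\<^sub>E level n) \<times> (level n \<rightarrow>\<^sub>E carrier E)"
    using eps_closed[OF section_in_hanoi]
    by (auto simp: F_def level_def extensional_def PiE_def simp del: exp_group_simps)
  then have "finite (F ` G)"
    using fin_level finite_exp by (meson finite_PiE finite_SigmaI finite_subset)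
  moreover have "g \<star> tree_inv h \<in> N" if gh: "g \<in> G" "h \<in> G" and eq: "F g = F h" for g h
  proof -
    have same: "g v = h v" "eps' (tree_section g v) = eps' (tree_section h v)" if "length v = n" for v
      using eq that by (auto simp: F_def level_def fun_eq_iff restrict_def split: if_splits)
    let ?u = "g \<star> tree_inv h"
    have "?u \<in> level_stab n" using same gh by (simp add: level_stab_def level_def)
    then have "?u = graft n (tree_section ?u)" by (rule graft_section[symmetric])
    moreover have "tree_section ?u v \<in> G'" if v: "length v = n" for v
    proof -
      have "tree_section ?u v = tree_section g v \<star> tree_inv (tree_section h v)"
        using gh same(1)[OF v] by (simp add: tree_section_mult tree_section_inv)
      then show ?thesis using eps_eq_iff same(2)[OF v] gh by simp
    qed
    ultimately show ?thesis using n by metis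
  qed
  ultimately have "finite (rcosets\<^bsub>aut_group G\<^esub> N)"
    using finite_rcosetsI[OF normal_imp_subgroup[OF N(1)]] by blast
  then show "finite (carrier (aut_group G Mod N))" by (simp add: FactGroup_def)
qed

end

section \<open>Reduction to a finite group\<close>

context spinal
begin

abbreviation F where "F \<equiv> fin_group \<sigma>"

lemma fin_group_simps:
  "carrier F = {f. \<forall>x. f x \<in> carrier E} \<times> root_group \<sigma>"
  "\<one>\<^bsub>F\<^esub> = (\<lambda>x. \<one>\<^bsub>E\<^esub>, id)"
  "(f, s) \<otimes>\<^bsub>F\<^esub> (g, t) = (\<lambda>x. f x \<otimes>\<^bsub>E\<^esub> g (s x), t \<circ> s)"
  by (simp_all add: fin_group_def)

lemma root_group_mult: "s \<in> root_group \<sigma> \<Longrightarrow> t \<in> root_group \<sigma> \<Longrightarrow> t \<circ> s \<in> root_group \<sigma>"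
  using subgroup.m_closed[OF subgroup_root_group, of s t] by simp

lemma root_group_id: "id \<in> root_group \<sigma>"
  using subgroup.one_closed[OF subgroup_root_group] by simp

lemma group_fin: "group F"
proof (rule groupI)
  fix u v assume "u \<in> carrier F" "v \<in> carrier F"
  then show "u \<otimes>\<^bsub>F\<^esub> v \<in> carrier F"
    by (cases u; cases v) (auto simp: fin_group_simps root_group_mult simp del: exp_group_simps)
next
  show "\<one>\<^bsub>F\<^esub> \<in> carrier F"
    by (simp add: fin_group_simps root_group_id del: exp_group_simps)
next
  fix u v w assume "u \<in> carrier F" "v \<in> carrier F" "w \<in> carrier F"
  then show "u \<otimes>\<^bsub>F\<^esub> v \<otimes>\<^bsub>F\<^esub> w = u \<otimes>\<^bsub>F\<^esub> (v \<otimes>\<^bsub>F\<^esub> w)"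
    by (cases u; cases v; cases w) (simp add: fin_group_simps comp_assoc E.m_assoc del: exp_group_simps)
next
  fix u assume "u \<in> carrier F"
  then show "\<one>\<^bsub>F\<^esub> \<otimes>\<^bsub>F\<^esub> u = u"
    by (cases u) (simp add: fin_group_simps del: exp_group_simps)
next
  fix u assume u: "u \<in> carrier F"
  obtain f s where fs: "u = (f, s)" by (cases u)
  then have s: "s \<in> root_group \<sigma>" and f: "\<And>x. f x \<in> carrier E"
    using u by (auto simp: fin_group_simps simp del: exp_group_simps)
  let ?t = "inv\<^bsub>Sym_right\<^esub> s"
  have t: "?t \<in> root_group \<sigma>" using subgroup.m_inv_closed[OF subgroup_root_group s] .
  have "s \<circ> ?t = id" using S.l_inv[of s] root_group_bij[OF s] by simp
  then have "(\<lambda>x. inv\<^bsub>E\<^esub> (f (?t x)), ?t) \<otimes>\<^bsub>F\<^esub> u = \<one>\<^bsub>F\<^esub>"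
    using f by (simp add: fin_group_simps fs E.l_inv del: exp_group_simps inv_exp)
  moreover have "(\<lambda>x. inv\<^bsub>E\<^esub> (f (?t x)), ?t) \<in> carrier F"
    using f t by (simp add: fin_group_simps del: exp_group_simps inv_exp)
  ultimately show "\<exists>v\<in>carrier F. v \<otimes>\<^bsub>F\<^esub> u = \<one>\<^bsub>F\<^esub>" by blast
qed

lemma finite_fin: "finite (carrier F)"
proof -
  have "{f. \<forall>x. f x \<in> carrier E} = ((UNIV :: 'x set) \<rightarrow>\<^sub>E carrier E)"
    by (auto simp: PiE_UNIV_domain)
  then have "finite {f :: 'x \<Rightarrow> 'x \<Rightarrow> int. \<forall>x. f x \<in> carrier E}"
    using finite_exp by (simp add: finite_PiE del: exp_group_simps)
  then show ?thesis by (simp add: fin_group_simps)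
qed

text \<open>
The domain on which reduction to the finite group is a homomorphism; it contains both \<open>G\<close> and \<open>J\<close>.
\<close>

definition reducible :: "('x list \<Rightarrow> 'x list) set" where
  "reducible = {g \<in> tree_auts. (\<forall>x. psi g x \<in> G) \<and> root_perm g \<in> root_group \<sigma>}"

lemma subgroup_reducible: "subgroup reducible tree_Aut"
proof (rule T.subgroupI)
  have "id \<in> reducible" by (simp add: reducible_def root_group_id)
  then show "reducible \<noteq> {}" by blast
next
  fix g assume g: "g \<in> reducible"
  have "psi (tree_inv g) y \<in> G" for y
  proof -
    have "bij (root_perm g)" using g by (simp add: reducible_def bij_root_perm)
    then obtain x where "y = root_perm g x" by (metis bij_pointE)
    then show ?thesis using g by (simp add: reducible_def psi_inv)
  qed
  then show "tree_inv g \<in> reducible"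
    using g subgroup.m_inv_closed[OF subgroup_root_group] by (simp add: reducible_def root_perm_inv)
next
  fix g h assume "g \<in> reducible" "h \<in> reducible"
  then show "g \<star> h \<in> reducible" by (simp add: reducible_def psi_mult root_group_mult)
qed (auto simp: reducible_def)

lemma hanoi_reducible: "G \<subseteq> reducible"
  by (auto simp: reducible_def root_group_eq)

lemma J_gens_reducible: "J_gens \<sigma> \<subseteq> reducible"
proof
  fix g assume "g \<in> J_gens \<sigma>"
  then obtain h p q where "g \<in> level_stab 1" "h \<in> G" and psi: "psi g = balanced p q h"
    unfolding J_gens_def balanced_def by blast
  then show "g \<in> reducible"
    by (simp add: reducible_def level_stab_1_iff root_group_id balanced_def del: One_nat_def)
qed

lemma J_reducible: "J_group \<sigma> \<subseteq> reducible"
  unfolding J_group_def by (rule T.generate_subgroup_incl[OF J_gens_reducible subgroup_reducible])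

lemma group_hom_fin_red: "group_hom (aut_group reducible) F (fin_red \<sigma>)"
proof (intro group_hom.intro group_hom_axioms.intro homI)
  show "group (aut_group reducible)" by (rule T.subgroup_imp_group[OF subgroup_reducible])
  show "group F" by (rule group_fin)
next
  fix g assume "g \<in> carrier (aut_group reducible)"
  then show "fin_red \<sigma> g \<in> carrier F"
    by (simp add: fin_red_def fin_group_simps reducible_def eps_closed del: exp_group_simps)
next
  fix g h assume "g \<in> carrier (aut_group reducible)" "h \<in> carrier (aut_group reducible)"
  then show "fin_red \<sigma> (g \<otimes>\<^bsub>aut_group reducible\<^esub> h) = fin_red \<sigma> g \<otimes>\<^bsub>F\<^esub> fin_red \<sigma> h"
    by (simp add: fin_red_def fin_group_simps reducible_def psi_mult eps_mult del: exp_group_simps)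
qed

lemma fin_red_generate:
  assumes "K \<subseteq> reducible"
  shows "fin_red \<sigma> ` generate tree_Aut K = generate F (fin_red \<sigma> ` K)"
  using group_hom.generate_img[OF group_hom_fin_red, of K]
    T.generate_consistent[OF assms subgroup_reducible] assms by simp

lemma fin_red_hanoi: "fin_red \<sigma> ` G = fin_G \<sigma>"
proof -
  have "fin_red \<sigma> (a i) = (\<lambda>x. if x = i then std_gen i else \<one>\<^bsub>E\<^esub>, \<sigma> i)" for i
    by (auto simp: fin_red_def eps_gen fun_eq_iff)
  then have "fin_red \<sigma> ` range a = range (\<lambda>i. (\<lambda>x. if x = i then std_gen i else \<one>\<^bsub>E\<^esub>, \<sigma> i))"
    by (simp add: image_image del: exp_group_simps)
  moreover have "range a \<subseteq> reducible" using hanoi_reducible gen_in_hanoi by blast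
  ultimately show ?thesis
    using fin_red_generate by (simp only: hanoi_group_def fin_G_def)
qed

lemma fin_red_balanced:
  assumes "h \<in> G" "psi g = balanced p q h" "root_perm g = id"
  shows "fin_red \<sigma> g =
    (\<lambda>x. if x = p then eps' h else if x = q then inv\<^bsub>E\<^esub> (eps' h) else \<one>\<^bsub>E\<^esub>, id)"
proof -
  have "eps' (psi g x) = (if x = p then eps' h else if x = q then inv\<^bsub>E\<^esub> (eps' h) else \<one>\<^bsub>E\<^esub>)" for x
    using assms(1) by (simp add: assms(2) balanced_def eps_inv del: exp_group_simps inv_exp)
  then show ?thesis by (simp only: fin_red_def assms(3))
qed

lemma fin_red_J: "fin_red \<sigma> ` J_group \<sigma> = fin_J \<sigma>"
proof -
  let ?K = "{(\<lambda>x :: 'x. if x = p then c else if x = q then inv\<^bsub>E\<^esub> c else \<one>\<^bsub>E\<^esub>, id :: 'x \<Rightarrow> 'x)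
       | c p q. c \<in> carrier E \<and> p \<noteq> q}"
  have "fin_red \<sigma> ` J_gens \<sigma> = ?K"
  proof (intro subset_antisym subsetI)
    fix u assume "u \<in> fin_red \<sigma> ` J_gens \<sigma>"
    then obtain g h p q where g: "u = fin_red \<sigma> g" "g \<in> level_stab 1" "h \<in> G" "p \<noteq> q" "psi g = balanced p q h"
      unfolding J_gens_def balanced_def by blast
    then have "u = (\<lambda>x. if x = p then eps' h else if x = q then inv\<^bsub>E\<^esub> (eps' h) else \<one>\<^bsub>E\<^esub>, id)"
      using fin_red_balanced[of h g p q] level_stab_1_iff by blast
    then show "u \<in> ?K" using eps_closed[OF g(3)] g(4) by blast
  next
    fix u :: "('x \<Rightarrow> 'x \<Rightarrow> int) \<times> ('x \<Rightarrow> 'x)" assume "u \<in> ?K"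
    then obtain c and p q :: 'x where u: "c \<in> carrier E" "p \<noteq> q"
      "u = (\<lambda>x. if x = p then c else if x = q then inv\<^bsub>E\<^esub> c else \<one>\<^bsub>E\<^esub>, id)" by blast
    obtain h where h: "h \<in> G" "eps' h = c" using u(1) by (rule eps_surj)
    let ?g = "node (balanced p q h) id"
    have "?g \<in> level_stab 1" using h by (simp add: level_stab_1_iff del: One_nat_def)
    then have "?g \<in> J_gens \<sigma>" unfolding J_gens_def using h(1) u(2) by (auto simp: balanced_def)
    moreover have "fin_red \<sigma> ?g = u"
      unfolding u(3) h(2)[symmetric] by (rule fin_red_balanced[OF h(1)]) simp_all
    ultimately show "u \<in> fin_red \<sigma> ` J_gens \<sigma>" by blast
  qed
  then show ?thesis
    using fin_red_generate[OF J_gens_reducible] by (simp only: J_group_def fin_J_def)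
qed

text \<open>
An automorphism with trivial reduction is a tuple over \<open>G'\<close>, and the regular branch property says that
such tuples lie in \<open>G\<close>.
\<close>

lemma fin_red_kernel:
  assumes "regular_branch_over G G'" "u \<in> reducible" "fin_red \<sigma> u = \<one>\<^bsub>F\<^esub>"
  shows "u \<in> G"
proof -
  have u: "u \<in> tree_auts" "\<And>x. psi u x \<in> G" using assms(2) by (auto simp: reducible_def)
  have root: "root_perm u = id" and eps: "\<And>x. eps' (psi u x) = \<one>\<^bsub>E\<^esub>"
    using assms(3) by (simp_all add: fin_red_def fin_group_simps fun_eq_iff)
  have "psi u x \<in> G'" for x using eps_eq_one_iff[OF u(2)] eps by blast
  then have "psi u \<in> psi ` (G' \<inter> level_stab 1)"
    using assms(1) unfolding regular_branch_over_def by blast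
  then obtain k where k: "k \<in> G'" "psi u = psi k" "root_perm k = id"
    by (auto simp: level_stab_1_iff simp del: One_nat_def)
  have "u = k"
    by (rule tree_aut_eqI) (simp_all add: u(1) k root)
  then show ?thesis using k(1) by simp
qed

lemma J_subset_iff:
  assumes "regular_branch_over G G'"
  shows "J_group \<sigma> \<subseteq> G \<longleftrightarrow> fin_J \<sigma> \<subseteq> fin_G \<sigma>"
proof
  assume "J_group \<sigma> \<subseteq> G"
  then show "fin_J \<sigma> \<subseteq> fin_G \<sigma>" unfolding fin_red_hanoi[symmetric] fin_red_J[symmetric] by (rule image_mono)
next
  assume sub: "fin_J \<sigma> \<subseteq> fin_G \<sigma>"
  interpret f: group_hom "aut_group reducible" F "fin_red \<sigma>" by (rule group_hom_fin_red)
  show "J_group \<sigma> \<subseteq> G"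
  proof
    fix j assume j: "j \<in> J_group \<sigma>"
    then have "fin_red \<sigma> j \<in> fin_red \<sigma> ` G"
      using sub unfolding fin_red_hanoi[symmetric] fin_red_J[symmetric] by blast
    then obtain g where g: "g \<in> G" "fin_red \<sigma> j = fin_red \<sigma> g" by blast
    have red: "j \<in> reducible" "g \<in> reducible" using j g J_reducible hanoi_reducible by blast+
    have inv: "inv\<^bsub>aut_group reducible\<^esub> g = tree_inv g"
      using T.m_inv_consistent[OF subgroup_reducible red(2)] .
    have "fin_red \<sigma> (j \<star> tree_inv g) = \<one>\<^bsub>F\<^esub>"
      using f.hom_mult[of j "tree_inv g"] f.hom_inv[of g] f.H.r_inv[of "fin_red \<sigma> g"] f.hom_closed[of g]
        f.G.inv_closed[of g] red g(2) by (simp add: inv)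
    moreover have "j \<star> tree_inv g \<in> reducible"
      using red subgroup.m_closed[OF subgroup_reducible] subgroup.m_inv_closed[OF subgroup_reducible] by blast
    ultimately have "j \<star> tree_inv g \<in> G" using fin_red_kernel[OF assms] by blast
    then have "j \<star> tree_inv g \<star> g \<in> G" using g(1) by simp
    then show "j \<in> G" using hanoi_closed[OF g(1)] by (simp add: tree_mult_assoc)
  qed
qed

end

section \<open>Groups containing \<open>J\<close> and the finite criterion\<close>

theorem theorem2:
  fixes \<sigma> :: "'x::finite \<Rightarrow> 'x \<Rightarrow> 'x"
  assumes "spinal_perms \<sigma>"
  shows
    "(level_transitive (hanoi_group \<sigma>) \<and> J_group \<sigma> \<subseteq> hanoi_group \<sigma> \<longrightarrow>
        strongly_fractal (hanoi_group \<sigma>) \<and>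
        regular_branch_over (hanoi_group \<sigma>) (hanoi_derived \<sigma>) \<and>
        psi ` (hanoi_group \<sigma> \<inter> level_stab 1) =
          {f. (\<forall>x. f x \<in> hanoi_group \<sigma>) \<and>
              (\<Otimes>\<^bsub>exp_group \<sigma>\<^esub>j\<in>UNIV. eps \<sigma> (f j)) \<in> kernel (exp_group \<sigma>) (root_ab \<sigma>) (lam \<sigma>)} \<and>
        (\<forall>m\<ge>1. psi_level m ` Rist (hanoi_group \<sigma>) m = (\<Pi>\<^sub>E v\<in>level m. B_group \<sigma>)) \<and>
        just_infinite (aut_group (hanoi_group \<sigma>))) \<and>
     (regular_branch_over (hanoi_group \<sigma>) (hanoi_derived \<sigma>) \<longrightarrow>
        group (fin_group \<sigma>) \<and> finite (carrier (fin_group \<sigma>)) \<and>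
        fin_red \<sigma> ` hanoi_group \<sigma> = fin_G \<sigma> \<and>
        fin_red \<sigma> ` J_group \<sigma> = fin_J \<sigma> \<and>
        (J_group \<sigma> \<subseteq> hanoi_group \<sigma> \<longleftrightarrow> fin_J \<sigma> \<subseteq> fin_G \<sigma>))"
proof -
  interpret spinal \<sigma> by unfold_locales (rule assms)
  show ?thesis
  proof (rule conjI; rule impI)
    assume hyps: "level_transitive (hanoi_group \<sigma>) \<and> J_group \<sigma> \<subseteq> hanoi_group \<sigma>"
    interpret hanoi_J \<sigma> by unfold_locales (use hyps in blast)+
    show "strongly_fractal (hanoi_group \<sigma>) \<and>
        regular_branch_over (hanoi_group \<sigma>) (hanoi_derived \<sigma>) \<and>
        psi ` (hanoi_group \<sigma> \<inter> level_stab 1) =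
          {f. (\<forall>x. f x \<in> hanoi_group \<sigma>) \<and>
              (\<Otimes>\<^bsub>exp_group \<sigma>\<^esub>j\<in>UNIV. eps \<sigma> (f j)) \<in> kernel (exp_group \<sigma>) (root_ab \<sigma>) (lam \<sigma>)} \<and>
        (\<forall>m\<ge>1. psi_level m ` Rist (hanoi_group \<sigma>) m = (\<Pi>\<^sub>E v\<in>level m. B_group \<sigma>)) \<and>
        just_infinite (aut_group (hanoi_group \<sigma>))"
      by (intro conjI allI impI hanoi_strongly_fractal hanoi_regular_branch psi_level_stab_hanoi
          psi_level_Rist hanoi_just_infinite)
  next
    assume branch: "regular_branch_over (hanoi_group \<sigma>) (hanoi_derived \<sigma>)"
    show "group (fin_group \<sigma>) \<and> finite (carrier (fin_group \<sigma>)) \<and>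
        fin_red \<sigma> ` hanoi_group \<sigma> = fin_G \<sigma> \<and>
        fin_red \<sigma> ` J_group \<sigma> = fin_J \<sigma> \<and>
        (J_group \<sigma> \<subseteq> hanoi_group \<sigma> \<longleftrightarrow> fin_J \<sigma> \<subseteq> fin_G \<sigma>)"
      by (intro conjI group_fin finite_fin fin_red_hanoi fin_red_J J_subset_iff branch)
  qed
qed

end
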